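(* Let $\omega$ be a PD prehamiltonian system on a fiber bundle $\alpha:P\to M$ with connected fiber. The $\mathbb{R}$-bilinear map $$\mathscr{C}(\omega)\times\mathscr{C}(\omega)\ni(f_1,f_2)\longmapsto\{f_1,f_2\}:=L_{Y_1}f_2\in\mathscr{C}(\omega),$$ where $Y_1$ is a PD Noether symmetry relative to $f_1$, is a Lie bracket.
   Context: Everything is smooth; $n=\dim M$. $V\mathrm{D}$ is the module of $\alpha$-vertical vector fields on $P$. $\Lambda_p^k$ is the module of $k$-forms $\omega$ on $P$ with $i_{Y_1}\cdots i_{Y_{k-p+1}}\omega=0$ for all $Y_j\in V\mathrm{D}$ (zero if $k<p$). Affine $q$-forms are identified with differential forms: $\Omega^q:=\Lambda_{n-1}^{q+n-1}$ (so $\Omega^0$ consists of the horizontal $(n-1)$-forms on $P$); $\delta$ is the restriction of the de Rham differential to $\Omega=\bigoplus_q\Omega^q$. A PD prehamiltonian system on $\alpha$ is an $\omega\in\Omega^2$ with $\delta\omega=0$. If $Y\in V\mathrm{D}$ and $f\in\Omega^0$ satisfy $i_Y\omega=\delta f$, then $Y$ is called a PD Noether symmetry and $f$ a PD Noether current of $\omega$, relative to each other; $\mathscr{S}(\omega)$ and $\mathscr{C}(\omega)$ are the sets (real vector spaces) of PD Noether symmetries and PD Noether currents. The form $L_{Y_1}f_2$ belongs to $\mathscr{C}(\omega)$ and does not depend on the choice of the PD Noether symmetry $Y_1$ relative to $f_1$. *)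

theory Defs
  imports "HOL-Analysis.Analysis" "HOL-Library.Function_Algebras"
begin

section \<open>Smooth functions on open subsets of Euclidean n-space\<close>

text \<open>
  Points of the n-dimensional space are sequences vanishing from index n on
  (\<^const>\<open>Euclidean_space\<close>), so that dimensions are ordinary natural numbers and may be 0.
  For open U, \<open>Ck_on n k U f\<close> says that the iterated partial derivatives of f of order at most k
  exist and are continuous on U.
\<close>

primrec Ck_on :: "nat \<Rightarrow> nat \<Rightarrow> (nat \<Rightarrow> real) set \<Rightarrow> ((nat \<Rightarrow> real) \<Rightarrow> real) \<Rightarrow> bool" where
  "Ck_on n 0 U f \<longleftrightarrow> continuous_map (subtopology (Euclidean_space n) U) euclideanreal f"
| "Ck_on n (Suc k) U f \<longleftrightarrow>
     continuous_map (subtopology (Euclidean_space n) U) euclideanreal f \<and>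
     (\<forall>i<n. \<exists>g. (\<forall>x\<in>U. ((\<lambda>t. f (x(i := t))) has_real_derivative g x) (at (x i))) \<and> Ck_on n k U g)"

definition smooth_on :: "nat \<Rightarrow> (nat \<Rightarrow> real) set \<Rightarrow> ((nat \<Rightarrow> real) \<Rightarrow> real) \<Rightarrow> bool" where
  "smooth_on n U f \<longleftrightarrow> (\<forall>k. Ck_on n k U f)"

section \<open>Smooth manifolds\<close>

type_synonym 'a chart = "'a set \<times> ('a \<Rightarrow> nat \<Rightarrow> real)"

record 'a manifold =
  mtop :: "'a topology"
  mdim :: nat
  matlas :: "'a chart set"

abbreviation mspace :: "'a manifold \<Rightarrow> 'a set" where
  "mspace N \<equiv> topspace (mtop N)"

definition smooth_manifold :: "'a manifold \<Rightarrow> bool" where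
  "smooth_manifold N \<longleftrightarrow>
     Hausdorff_space (mtop N) \<and> second_countable (mtop N) \<and>
     (\<Union>(U, \<phi>)\<in>matlas N. U) = mspace N \<and>
     (\<forall>(U, \<phi>)\<in>matlas N.
        openin (mtop N) U \<and> openin (Euclidean_space (mdim N)) (\<phi> ` U) \<and>
        homeomorphic_map (subtopology (mtop N) U)
          (subtopology (Euclidean_space (mdim N)) (\<phi> ` U)) \<phi>) \<and>
     (\<forall>(U, \<phi>)\<in>matlas N. \<forall>(V, \<psi>)\<in>matlas N. \<forall>i<mdim N.
        smooth_on (mdim N) (\<phi> ` (U \<inter> V)) (\<lambda>x. \<psi> (inv_into U \<phi> x) i))"

definition smooth_map :: "'a manifold \<Rightarrow> 'b manifold \<Rightarrow> ('a \<Rightarrow> 'b) \<Rightarrow> bool" where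
  "smooth_map N N' h \<longleftrightarrow>
     continuous_map (mtop N) (mtop N') h \<and>
     (\<forall>(U, \<phi>)\<in>matlas N. \<forall>(V, \<psi>)\<in>matlas N'. \<forall>i<mdim N'.
        smooth_on (mdim N) (\<phi> ` (U \<inter> h -` V)) (\<lambda>x. \<psi> (h (inv_into U \<phi> x)) i))"

definition diffeomorphism :: "'a manifold \<Rightarrow> 'b manifold \<Rightarrow> ('a \<Rightarrow> 'b) \<Rightarrow> bool" where
  "diffeomorphism N N' h \<longleftrightarrow>
     smooth_map N N' h \<and>
     (\<exists>h'. smooth_map N' N h' \<and> (\<forall>x\<in>mspace N. h' (h x) = x) \<and> (\<forall>y\<in>mspace N'. h (h' y) = y))"

definition open_submanifold :: "'a manifold \<Rightarrow> 'a set \<Rightarrow> 'a manifold" where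
  "open_submanifold N W =
     \<lparr>mtop = subtopology (mtop N) W, mdim = mdim N, matlas = (\<lambda>(U, \<phi>). (U \<inter> W, \<phi>)) ` matlas N\<rparr>"

definition product_chart :: "nat \<Rightarrow> 'a chart \<Rightarrow> 'b chart \<Rightarrow> ('a \<times> 'b) chart" where
  "product_chart n c c' =
     (fst c \<times> fst c', \<lambda>(a, b) i. if i < n then snd c a i else snd c' b (i - n))"

definition product_manifold :: "'a manifold \<Rightarrow> 'b manifold \<Rightarrow> ('a \<times> 'b) manifold" where
  "product_manifold N N' =
     \<lparr>mtop = prod_topology (mtop N) (mtop N'), mdim = mdim N + mdim N',
      matlas = {product_chart (mdim N) c c' | c c'. c \<in> matlas N \<and> c' \<in> matlas N'}\<rparr>"

definition fiber_bundle :: "'p manifold \<Rightarrow> 'm manifold \<Rightarrow> 'f manifold \<Rightarrow> ('p \<Rightarrow> 'm) \<Rightarrow> bool" where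
  "fiber_bundle P M F \<alpha> \<longleftrightarrow>
     smooth_manifold P \<and> smooth_manifold M \<and> smooth_manifold F \<and> mspace F \<noteq> {} \<and>
     smooth_map P M \<alpha> \<and>
     (\<forall>x\<in>mspace M. \<exists>W \<tau>. openin (mtop M) W \<and> x \<in> W \<and>
        diffeomorphism (open_submanifold P (\<alpha> -` W \<inter> mspace P))
          (product_manifold (open_submanifold M W) F) \<tau> \<and>
        (\<forall>p\<in>\<alpha> -` W \<inter> mspace P. fst (\<tau> p) = \<alpha> p))"

section \<open>Functions, vector fields and differential forms\<close>

text \<open>
  Functions on a manifold are represented by total functions that are 0 off its carrier; likewise
  vector fields and forms are total functions with value 0 on improper arguments. So each smooth
  object has exactly one representative, equations between them are equations in HOL, and the
  pointwise ring structure on function types serves as the algebraic structure.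
\<close>

type_synonym 'a vfield = "('a \<Rightarrow> real) \<Rightarrow> ('a \<Rightarrow> real)"

text \<open>A k-form takes its k arguments as a list; a 0-form g is \<open>[] \<mapsto> g\<close>.\<close>

type_synonym 'a form = "'a vfield list \<Rightarrow> ('a \<Rightarrow> real)"

definition smooth_functions :: "'a manifold \<Rightarrow> ('a \<Rightarrow> real) set" where
  "smooth_functions N =
     {f. (\<forall>x. x \<notin> mspace N \<longrightarrow> f x = 0) \<and>
         (\<forall>(U, \<phi>)\<in>matlas N. smooth_on (mdim N) (\<phi> ` U) (\<lambda>x. f (inv_into U \<phi> x)))}"

text \<open>Vector fields are the derivations of the real algebra of smooth functions.\<close>

definition vector_fields :: "'a manifold \<Rightarrow> 'a vfield set" where
  "vector_fields N =
     {X. (\<forall>f. f \<notin> smooth_functions N \<longrightarrow> X f = 0) \<and>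
         (\<forall>f\<in>smooth_functions N. X f \<in> smooth_functions N) \<and>
         (\<forall>f\<in>smooth_functions N. \<forall>g\<in>smooth_functions N. X (f + g) = X f + X g) \<and>
         (\<forall>f\<in>smooth_functions N. \<forall>c. X (\<lambda>x. c * f x) = (\<lambda>x. c * X f x)) \<and>
         (\<forall>f\<in>smooth_functions N. \<forall>g\<in>smooth_functions N. X (f * g) = X f * g + f * X g)}"

definition vf_bracket :: "'a vfield \<Rightarrow> 'a vfield \<Rightarrow> 'a vfield" where
  "vf_bracket X Y = (\<lambda>f. X (Y f) - Y (X f))"

text \<open>
  Differential k-forms are the alternating multilinear maps from vector fields to functions,
  linear over the ring of smooth functions. The degree is an integer; for negative k only the
  zero form is left.
\<close>

definition forms :: "'a manifold \<Rightarrow> int \<Rightarrow> 'a form set" where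
  "forms N k =
     {\<omega>. (\<forall>Xs. \<not> (set Xs \<subseteq> vector_fields N \<and> int (length Xs) = k) \<longrightarrow> \<omega> Xs = 0) \<and>
         (\<forall>Xs. \<omega> Xs \<in> smooth_functions N) \<and>
         (\<forall>As Bs. \<forall>X\<in>vector_fields N. \<forall>Y\<in>vector_fields N.
            set As \<subseteq> vector_fields N \<longrightarrow> set Bs \<subseteq> vector_fields N \<longrightarrow>
            \<omega> (As @ (X + Y) # Bs) = \<omega> (As @ X # Bs) + \<omega> (As @ Y # Bs)) \<and>
         (\<forall>As Bs. \<forall>f\<in>smooth_functions N. \<forall>X\<in>vector_fields N.
            set As \<subseteq> vector_fields N \<longrightarrow> set Bs \<subseteq> vector_fields N \<longrightarrow>
            \<omega> (As @ (\<lambda>g. f * X g) # Bs) = f * \<omega> (As @ X # Bs)) \<and>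
         (\<forall>Xs. \<not> distinct Xs \<longrightarrow> \<omega> Xs = 0)}"

definition insertion :: "'a vfield \<Rightarrow> 'a form \<Rightarrow> 'a form" where
  "insertion Y \<omega> = (\<lambda>Xs. \<omega> (Y # Xs))"

definition omit :: "nat \<Rightarrow> 'b list \<Rightarrow> 'b list" where
  "omit i xs = take i xs @ drop (Suc i) xs"

text \<open>The de Rham differential by its invariant formula, with arguments numbered from 0.\<close>

definition ext_deriv :: "'a manifold \<Rightarrow> 'a form \<Rightarrow> 'a form" where
  "ext_deriv N \<omega> = (\<lambda>Xs. if set Xs \<subseteq> vector_fields N then
       (\<Sum>i<length Xs. (-1) ^ i * (Xs ! i) (\<omega> (omit i Xs))) +
       (\<Sum>j<length Xs. \<Sum>i<j. (-1) ^ (i + j) *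
          \<omega> (vf_bracket (Xs ! i) (Xs ! j) # omit i (omit j Xs)))
     else 0)"

definition lie_deriv :: "'a manifold \<Rightarrow> 'a vfield \<Rightarrow> 'a form \<Rightarrow> 'a form" where
  "lie_deriv N X \<omega> = (\<lambda>Xs. if set Xs \<subseteq> vector_fields N then
       X (\<omega> Xs) - (\<Sum>i<length Xs. \<omega> (Xs[i := vf_bracket X (Xs ! i)]))
     else 0)"

section \<open>PD prehamiltonian systems\<close>

definition pullback :: "'p manifold \<Rightarrow> ('p \<Rightarrow> 'm) \<Rightarrow> ('m \<Rightarrow> real) \<Rightarrow> ('p \<Rightarrow> real)" where
  "pullback P \<alpha> g = (\<lambda>p. if p \<in> mspace P then g (\<alpha> p) else 0)"

definition vertical_fields :: "'p manifold \<Rightarrow> 'm manifold \<Rightarrow> ('p \<Rightarrow> 'm) \<Rightarrow> 'p vfield set" where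
  "vertical_fields P M \<alpha> =
     {Y \<in> vector_fields P. \<forall>g\<in>smooth_functions M. Y (pullback P \<alpha> g) = 0}"

text \<open>\<open>Lambda P M \<alpha> p k\<close>: the k-forms killed by inserting any k - p + 1 vertical vector fields.\<close>

definition Lambda :: "'p manifold \<Rightarrow> 'm manifold \<Rightarrow> ('p \<Rightarrow> 'm) \<Rightarrow> int \<Rightarrow> int \<Rightarrow> 'p form set" where
  "Lambda P M \<alpha> p k =
     (if k < p then {0}
      else {\<omega> \<in> forms P k.
              \<forall>Ys. set Ys \<subseteq> vertical_fields P M \<alpha> \<longrightarrow> int (length Ys) = k - p + 1 \<longrightarrow>
                   foldr insertion Ys \<omega> = 0})"

text \<open>
  Affine q-forms, as differential forms. Since \<^const>\<open>ext_deriv\<close> does not depend on the degree,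
  it serves as the differential here too. Integer degrees give the base dimension 0 its expected
  meaning: then the affine 0-forms are forms of degree -1, that is, 0.
\<close>

definition Omega :: "'p manifold \<Rightarrow> 'm manifold \<Rightarrow> ('p \<Rightarrow> 'm) \<Rightarrow> int \<Rightarrow> 'p form set" where
  "Omega P M \<alpha> q = Lambda P M \<alpha> (int (mdim M) - 1) (q + int (mdim M) - 1)"

definition pd_prehamiltonian :: "'p manifold \<Rightarrow> 'm manifold \<Rightarrow> ('p \<Rightarrow> 'm) \<Rightarrow> 'p form \<Rightarrow> bool" where
  "pd_prehamiltonian P M \<alpha> \<omega> \<longleftrightarrow> \<omega> \<in> Omega P M \<alpha> 2 \<and> ext_deriv P \<omega> = 0"

text \<open>Y is a PD Noether symmetry and f a PD Noether current, relative to each other.\<close>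

definition pd_noether ::
  "'p manifold \<Rightarrow> 'm manifold \<Rightarrow> ('p \<Rightarrow> 'm) \<Rightarrow> 'p form \<Rightarrow> 'p vfield \<Rightarrow> 'p form \<Rightarrow> bool" where
  "pd_noether P M \<alpha> \<omega> Y f \<longleftrightarrow>
     Y \<in> vertical_fields P M \<alpha> \<and> f \<in> Omega P M \<alpha> 0 \<and> insertion Y \<omega> = ext_deriv P f"

definition noether_currents ::
  "'p manifold \<Rightarrow> 'm manifold \<Rightarrow> ('p \<Rightarrow> 'm) \<Rightarrow> 'p form \<Rightarrow> 'p form set" where
  "noether_currents P M \<alpha> \<omega> = {f. \<exists>Y. pd_noether P M \<alpha> \<omega> Y f}"

definition current_bracket ::
  "'p manifold \<Rightarrow> 'm manifold \<Rightarrow> ('p \<Rightarrow> 'm) \<Rightarrow> 'p form \<Rightarrow> 'p form \<Rightarrow> 'p form \<Rightarrow> 'p form" where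
  "current_bracket P M \<alpha> \<omega> f1 f2 = lie_deriv P (SOME Y1. pd_noether P M \<alpha> \<omega> Y1 f1) f2"

section \<open>Lie brackets on real vector spaces of forms\<close>

definition scale_form :: "real \<Rightarrow> 'a form \<Rightarrow> 'a form" where
  "scale_form c \<omega> = (\<lambda>Xs x. c * \<omega> Xs x)"

definition lie_bracket_on :: "'a form set \<Rightarrow> ('a form \<Rightarrow> 'a form \<Rightarrow> 'a form) \<Rightarrow> bool" where
  "lie_bracket_on V br \<longleftrightarrow>
     0 \<in> V \<and> (\<forall>f\<in>V. \<forall>g\<in>V. f + g \<in> V) \<and> (\<forall>c. \<forall>f\<in>V. scale_form c f \<in> V) \<and>
     (\<forall>f\<in>V. \<forall>g\<in>V. br f g \<in> V) \<and>
     (\<forall>f\<in>V. \<forall>g\<in>V. \<forall>h\<in>V. br (f + g) h = br f h + br g h \<and> br h (f + g) = br h f + br h g) \<and>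
     (\<forall>c. \<forall>f\<in>V. \<forall>g\<in>V. br (scale_form c f) g = scale_form c (br f g) \<and>
                     br f (scale_form c g) = scale_form c (br f g)) \<and>
     (\<forall>f\<in>V. br f f = 0) \<and>
     (\<forall>f\<in>V. \<forall>g\<in>V. \<forall>h\<in>V. br f (br g h) + br g (br h f) + br h (br f g) = 0)"

end

theory Submission
  imports Defs
begin

text \<open>
  Write \<open>i\<^sub>Y\<close>, \<open>L\<^sub>Y\<close>, d for insertion, Lie derivative and exterior derivative, and let Y, Z be
  Noether symmetries relative to the currents f, g. Currents are horizontal, so \<open>i\<^sub>Y g = 0\<close>
  and Cartan's formula gives
  \<open>{f, g} = L\<^sub>Y g = i\<^sub>Y d g = i\<^sub>Y i\<^sub>Z \<omega>\<close> (\<open>lie_deriv_current\<close>).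
  This expression is skew in (Y, f) and (Z, g). Since it depends on Y only through
  \<open>i\<^sub>Y \<omega> = d f\<close>, the bracket does not depend on the choice of Y. It is also a horizontal form, as
  \<open>\<omega>\<close> is killed by any three vertical insertions.

  The bracket is a current relative to [Y, Z] (\<open>noether_bracket\<close>): as \<open>d \<omega> = 0\<close>, we have
  \<open>L\<^sub>Y \<omega> = d i\<^sub>Y \<omega> = d d f = 0\<close>, hence \<open>i\<^bsub>[Y,Z]\<^esub> \<omega> = L\<^sub>Y i\<^sub>Z \<omega> = L\<^sub>Y d g = d L\<^sub>Y g\<close>. The Jacobi
  identity is then \<open>L\<^bsub>[X,Y]\<^esub> = L\<^sub>X L\<^sub>Y - L\<^sub>Y L\<^sub>X\<close> combined with skewness.

  So everything rests on the Cartan calculus for forms given as alternating functions of lists of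
  vector fields. The combinatorics of signs and omitted arguments occurs once, in Cartan's formula
  \<open>ext_deriv_Cons\<close>. Together with the analogous unfolding \<open>lie_deriv_Cons\<close> it turns d and \<open>L\<^sub>X\<close>
  into functions recursive in the argument list, and the identities \<open>L\<^bsub>[X,Y]\<^esub> = [L\<^sub>X, L\<^sub>Y]\<close>,
  \<open>L\<^sub>X d = d L\<^sub>X\<close> and \<open>d d = 0\<close> follow by induction on that list, for all forms simultaneously.
\<close>

section \<open>Smooth functions\<close>

lemma Ck_on_continuous:
  assumes "Ck_on n k U f"
  shows "continuous_map (subtopology (Euclidean_space n) U) euclideanreal f"
proof (cases k)
  case 0
  from assms show ?thesis
    unfolding 0 Ck_on.simps(1) .
next
  case (Suc k')
  from assms show ?thesis
    unfolding Suc Ck_on.simps(2) by (rule conjunct1)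
qed

lemma Ck_on_SucI:
  assumes "continuous_map (subtopology (Euclidean_space n) U) euclideanreal f"
    and "\<And>i. i < n \<Longrightarrow>
      \<exists>g. (\<forall>x\<in>U. ((\<lambda>t. f (x(i := t))) has_real_derivative g x) (at (x i))) \<and> Ck_on n k U g"
  shows "Ck_on n (Suc k) U f"
  unfolding Ck_on.simps(2) using assms by blast

lemma Ck_on_SucE:
  assumes "Ck_on n (Suc k) U f" "i < n"
  obtains g where "\<And>x. x \<in> U \<Longrightarrow> ((\<lambda>t. f (x(i := t))) has_real_derivative g x) (at (x i))"
    and "Ck_on n k U g"
  using assms unfolding Ck_on.simps(2) by blast

lemma Ck_on_Suc_imp: "Ck_on n (Suc k) U f \<Longrightarrow> Ck_on n k U f"
proof (induction k arbitrary: f)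
  case 0
  then show ?case
    unfolding Ck_on.simps(1) by (rule Ck_on_continuous)
next
  case (Suc k)
  show ?case
  proof (rule Ck_on_SucI)
    fix i assume "i < n"
    then obtain g
      where "\<And>x. x \<in> U \<Longrightarrow> ((\<lambda>t. f (x(i := t))) has_real_derivative g x) (at (x i))"
        and "Ck_on n (Suc k) U g"
      using Ck_on_SucE[OF Suc.prems] by blast
    then show "\<exists>g. (\<forall>x\<in>U. ((\<lambda>t. f (x(i := t))) has_real_derivative g x) (at (x i))) \<and>
        Ck_on n k U g"
      using Suc.IH by blast
  qed (rule Ck_on_continuous[OF Suc.prems])
qed

lemma Ck_on_add: "Ck_on n k U f \<Longrightarrow> Ck_on n k U g \<Longrightarrow> Ck_on n k U (\<lambda>x. f x + g x)"
proof (induction k arbitrary: f g)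
  case 0
  then show ?case by (simp add: continuous_map_add)
next
  case (Suc k)
  show ?case
  proof (rule Ck_on_SucI)
    fix i assume "i < n"
    obtain f' g'
      where f': "\<And>x. x \<in> U \<Longrightarrow> ((\<lambda>t. f (x(i := t))) has_real_derivative f' x) (at (x i))"
          "Ck_on n k U f'"
        and g': "\<And>x. x \<in> U \<Longrightarrow> ((\<lambda>t. g (x(i := t))) has_real_derivative g' x) (at (x i))"
          "Ck_on n k U g'"
      using Suc.prems[THEN Ck_on_SucE[OF _ \<open>i < n\<close>]] by metis
    have "((\<lambda>t. f (x(i := t)) + g (x(i := t))) has_real_derivative f' x + g' x) (at (x i))"
      if "x \<in> U" for x
      using DERIV_add[OF f'(1)[OF that] g'(1)[OF that]] .
    moreover have "Ck_on n k U (\<lambda>x. f' x + g' x)"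
      by (rule Suc.IH[OF f'(2) g'(2)])
    ultimately show "\<exists>h. (\<forall>x\<in>U. ((\<lambda>t. f (x(i := t)) + g (x(i := t))) has_real_derivative h x)
        (at (x i))) \<and> Ck_on n k U h"
      by (intro exI conjI ballI)
  qed (intro continuous_map_add Suc.prems[THEN Ck_on_continuous])
qed

lemma Ck_on_mult: "Ck_on n k U f \<Longrightarrow> Ck_on n k U g \<Longrightarrow> Ck_on n k U (\<lambda>x. f x * g x)"
proof (induction k arbitrary: f g)
  case 0
  then show ?case by (simp add: continuous_map_real_mult)
next
  case (Suc k)
  show ?case
  proof (rule Ck_on_SucI)
    fix i assume "i < n"
    obtain f' g'
      where f': "\<And>x. x \<in> U \<Longrightarrow> ((\<lambda>t. f (x(i := t))) has_real_derivative f' x) (at (x i))"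
          "Ck_on n k U f'"
        and g': "\<And>x. x \<in> U \<Longrightarrow> ((\<lambda>t. g (x(i := t))) has_real_derivative g' x) (at (x i))"
          "Ck_on n k U g'"
      using Suc.prems[THEN Ck_on_SucE[OF _ \<open>i < n\<close>]] by metis
    have "((\<lambda>t. f (x(i := t)) * g (x(i := t))) has_real_derivative f' x * g x + g' x * f x) (at (x i))"
      if "x \<in> U" for x
      using DERIV_mult[OF f'(1)[OF that] g'(1)[OF that]] unfolding fun_upd_triv .
    \<comment> \<open>The undifferentiated factors f and g are used with one order less than they have.\<close>
    moreover have "Ck_on n k U (\<lambda>x. f' x * g x + g' x * f x)"
      using Suc.prems[THEN Ck_on_Suc_imp] f'(2) g'(2) by (intro Ck_on_add Suc.IH)
    ultimately show "\<exists>h. (\<forall>x\<in>U. ((\<lambda>t. f (x(i := t)) * g (x(i := t))) has_real_derivative h x)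
        (at (x i))) \<and> Ck_on n k U h"
      by (intro exI conjI ballI)
  qed (intro continuous_map_real_mult Suc.prems[THEN Ck_on_continuous])
qed

text \<open>
  A partial derivative at x depends on the function near x along a coordinate line, so statements
  that hold only on U can be differentiated because U meets such a line in an open set.
\<close>

lemma open_coordinate_line:
  assumes "openin (Euclidean_space n) U" "x \<in> U" "i < n"
  shows "open {t. x(i := t) \<in> U}"
proof -
  have x: "x j = 0" if "j \<ge> n" for j
    using openin_subset[OF assms(1)] assms(2) that by (auto simp: topspace_Euclidean_space)
  have "continuous_map euclideanreal euclideanreal (\<lambda>t. if j = i then t else x j)" for j
    by (cases "j = i") auto
  then have "continuous_map euclideanreal (Euclidean_space n)
      (\<lambda>t j. if j < n then (if j = i then t else x j) else 0)"
    by (subst continuous_map_componentwise_Euclidean_space) auto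
  also have "(\<lambda>t j. if j < n then (if j = i then t else x j) else 0) = (\<lambda>t. x(i := t))"
    using x assms(3) by (fastforce simp: fun_eq_iff)
  finally have "openin euclideanreal {t \<in> topspace euclideanreal. x(i := t) \<in> U}"
    by (rule openin_continuous_map_preimage[OF _ assms(1)])
  then show ?thesis by simp
qed

text \<open>
  Only the values on U are prescribed: the coordinate expression of a function on a manifold is
  arbitrary outside the image of the chart.
\<close>

lemma Ck_on_const:
  assumes "openin (Euclidean_space n) U" "\<forall>x\<in>U. f x = c"
  shows "Ck_on n k U f"
  using assms(2)
proof (induction k arbitrary: c f)
  case 0
  then show ?case
    by (auto intro: continuous_map_eq[where f = "\<lambda>_. c"])
next
  case (Suc k)
  have "((\<lambda>t. f (x(i := t))) has_real_derivative 0) (at (x i))" if "i < n" "x \<in> U" for i x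
    by (rule has_field_derivative_transform_within_open
          [OF DERIV_const open_coordinate_line[OF assms(1) that(2,1)]])
      (use that Suc.prems in auto)
  moreover have "Ck_on n k U (\<lambda>_. 0)"
    by (rule Suc.IH) blast
  moreover have "continuous_map (subtopology (Euclidean_space n) U) euclideanreal f"
    using Suc.prems by (auto intro: continuous_map_eq[where f = "\<lambda>_. c"])
  ultimately show ?case
    by (intro Ck_on_SucI exI[of _ "\<lambda>_. 0"] conjI ballI)
qed

lemma smooth_functions_add:
  "f \<in> smooth_functions N \<Longrightarrow> g \<in> smooth_functions N \<Longrightarrow> f + g \<in> smooth_functions N"
  unfolding smooth_functions_def smooth_on_def by (fastforce intro: Ck_on_add)

lemma smooth_functions_mult:
  "f \<in> smooth_functions N \<Longrightarrow> g \<in> smooth_functions N \<Longrightarrow> f * g \<in> smooth_functions N"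
  unfolding smooth_functions_def smooth_on_def by (fastforce intro: Ck_on_mult)

text \<open>
  Functions on N vanish off the carrier, so this is the constant function c as an element of the
  algebra of smooth functions. Multiplication by it is scaling by c, which makes linearity over
  functions include linearity over the reals.
\<close>

definition constant_fun :: "'a manifold \<Rightarrow> real \<Rightarrow> 'a \<Rightarrow> real" where
  "constant_fun N c = (\<lambda>x. if x \<in> mspace N then c else 0)"

lemma constant_fun_smooth:
  assumes "smooth_manifold N"
  shows "constant_fun N c \<in> smooth_functions N"
proof -
  have "smooth_on (mdim N) (\<phi> ` U) (\<lambda>x. constant_fun N c (inv_into U \<phi> x))"
    if "(U, \<phi>) \<in> matlas N" for U \<phi>
  proof -
    have "openin (Euclidean_space (mdim N)) (\<phi> ` U)" "U \<subseteq> mspace N"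
      using assms that by (auto simp: smooth_manifold_def)
    moreover have "constant_fun N c (inv_into U \<phi> x) = c" if "x \<in> \<phi> ` U" for x
      using inv_into_into[OF that] \<open>U \<subseteq> mspace N\<close> by (auto simp: constant_fun_def)
    ultimately show ?thesis
      by (auto simp: smooth_on_def intro: Ck_on_const)
  qed
  then show ?thesis
    by (auto simp: smooth_functions_def constant_fun_def)
qed

lemma constant_fun_mult:
  "f \<in> smooth_functions N \<Longrightarrow> constant_fun N c * f = (\<lambda>x. c * f x)"
  by (auto simp: smooth_functions_def constant_fun_def fun_eq_iff)

lemma smooth_functions_scale:
  "smooth_manifold N \<Longrightarrow> f \<in> smooth_functions N \<Longrightarrow> (\<lambda>x. c * f x) \<in> smooth_functions N"
  using smooth_functions_mult[OF constant_fun_smooth, of N f c] by (simp add: constant_fun_mult)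

lemma smooth_functions_zero: "smooth_manifold N \<Longrightarrow> 0 \<in> smooth_functions N"
  using constant_fun_smooth[of N 0] by (simp add: constant_fun_def zero_fun_def)

lemma smooth_functions_uminus:
  "smooth_manifold N \<Longrightarrow> f \<in> smooth_functions N \<Longrightarrow> - f \<in> smooth_functions N"
  using smooth_functions_scale[of N f "-1"] by (simp add: fun_Compl_def)

lemma smooth_functions_diff:
  "smooth_manifold N \<Longrightarrow> f \<in> smooth_functions N \<Longrightarrow> g \<in> smooth_functions N
    \<Longrightarrow> f - g \<in> smooth_functions N"
  using smooth_functions_add[of f N "- g"] smooth_functions_uminus[of N g] by simp

section \<open>The Lie algebra of vector fields\<close>

lemma vf_smooth: "X \<in> vector_fields N \<Longrightarrow> f \<in> smooth_functions N \<Longrightarrow> X f \<in> smooth_functions N"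
  by (simp add: vector_fields_def)

lemma vf_add:
  "X \<in> vector_fields N \<Longrightarrow> f \<in> smooth_functions N \<Longrightarrow> g \<in> smooth_functions N
    \<Longrightarrow> X (f + g) = X f + X g"
  by (simp add: vector_fields_def)

lemma vf_scale:
  "X \<in> vector_fields N \<Longrightarrow> f \<in> smooth_functions N \<Longrightarrow> X (\<lambda>x. c * f x) = (\<lambda>x. c * X f x)"
  by (simp add: vector_fields_def)

lemma vf_mult:
  "X \<in> vector_fields N \<Longrightarrow> f \<in> smooth_functions N \<Longrightarrow> g \<in> smooth_functions N
    \<Longrightarrow> X (f * g) = X f * g + f * X g"
  by (simp add: vector_fields_def)

lemma vf_nonsmooth: "X \<in> vector_fields N \<Longrightarrow> f \<notin> smooth_functions N \<Longrightarrow> X f = 0"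
  by (simp add: vector_fields_def)

lemma vf_uminus: "X \<in> vector_fields N \<Longrightarrow> f \<in> smooth_functions N \<Longrightarrow> X (- f) = - X f"
  using vf_scale[of X N f "-1"] by (simp add: fun_Compl_def)

lemma vf_zero: "smooth_manifold N \<Longrightarrow> X \<in> vector_fields N \<Longrightarrow> X 0 = 0"
  using vf_add[of X N 0 0] smooth_functions_zero[of N] by simp

lemma vf_diff:
  "smooth_manifold N \<Longrightarrow> X \<in> vector_fields N \<Longrightarrow> f \<in> smooth_functions N
    \<Longrightarrow> g \<in> smooth_functions N \<Longrightarrow> X (f - g) = X f - X g"
  using vf_add[of X N f "- g"] by (simp add: smooth_functions_uminus vf_uminus[of X N g])

lemma vector_fields_zero: "smooth_manifold N \<Longrightarrow> 0 \<in> vector_fields N"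
  by (auto simp: vector_fields_def smooth_functions_zero)

lemma vector_fields_add:
  "X \<in> vector_fields N \<Longrightarrow> Y \<in> vector_fields N \<Longrightarrow> X + Y \<in> vector_fields N"
  by (auto simp: vector_fields_def smooth_functions_add algebra_simps fun_eq_iff)

lemma vector_fields_scale:
  "smooth_manifold N \<Longrightarrow> X \<in> vector_fields N \<Longrightarrow> (\<lambda>g x. c * X g x) \<in> vector_fields N"
  by (auto simp: vector_fields_def smooth_functions_scale algebra_simps fun_eq_iff)

lemma vector_fields_bracket:
  assumes "smooth_manifold N" "X \<in> vector_fields N" "Y \<in> vector_fields N"
  shows "vf_bracket X Y \<in> vector_fields N"
proof -
  note rules = vf_smooth[OF assms(2)] vf_smooth[OF assms(3)]
    smooth_functions_add smooth_functions_mult smooth_functions_scale[OF assms(1)]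
    smooth_functions_diff[OF assms(1)]
    vf_add[OF assms(2)] vf_add[OF assms(3)] vf_mult[OF assms(2)] vf_mult[OF assms(3)]
    vf_scale[OF assms(2)] vf_scale[OF assms(3)] vf_nonsmooth[OF assms(2)] vf_nonsmooth[OF assms(3)]
    vf_zero[OF assms(1,2)] vf_zero[OF assms(1,3)]
  show ?thesis
    unfolding vector_fields_def vf_bracket_def
    by (auto simp: rules algebra_simps)
qed

lemma vf_bracket_sum_flip: "vf_bracket X Y + vf_bracket Y X = 0"
  by (simp add: vf_bracket_def fun_eq_iff)

text \<open>
  The Jacobi identity in Leibniz form: bracketing with X is a derivation of the bracket. The terms
  cancel as they do for commutators of any additive maps.
\<close>

lemma vf_bracket_jacobi:
  assumes "smooth_manifold N" "X \<in> vector_fields N" "Y \<in> vector_fields N" "Z \<in> vector_fields N"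
  shows "vf_bracket X (vf_bracket Y Z) = vf_bracket (vf_bracket X Y) Z + vf_bracket Y (vf_bracket X Z)"
proof
  fix f
  show "vf_bracket X (vf_bracket Y Z) f = (vf_bracket (vf_bracket X Y) Z + vf_bracket Y (vf_bracket X Z)) f"
  proof (cases "f \<in> smooth_functions N")
    case True
    then show ?thesis
      using assms
      by (simp add: vf_bracket_def vf_smooth[of X N] vf_smooth[of Y N] vf_smooth[of Z N]
          vf_diff[of N X] vf_diff[of N Y] vf_diff[of N Z])
  next
    case False
    then show ?thesis
      using assms
      by (simp add: vf_bracket_def vf_nonsmooth[of X N] vf_nonsmooth[of Y N] vf_nonsmooth[of Z N]
          vf_zero[of N X] vf_zero[of N Y] vf_zero[of N Z])
  qed
qed


section \<open>Cartan calculus\<close>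

text \<open>
  Being a form is split in two: the part that induction on the argument list carries over to
  \<open>L\<^sub>X f\<close> and d f (\<open>alternating\<close>), and the additivity through which identities between brackets
  enter the argument places (\<open>multiadditive\<close>).
\<close>

definition alternating :: "'a manifold \<Rightarrow> 'a form \<Rightarrow> bool" where
  "alternating N f \<longleftrightarrow>
     (\<forall>Xs. f Xs \<in> smooth_functions N) \<and>
     (\<forall>Xs. \<not> set Xs \<subseteq> vector_fields N \<longrightarrow> f Xs = 0) \<and>
     (\<forall>As X Y Bs. f (As @ X # Y # Bs) = - f (As @ Y # X # Bs))"

definition multiadditive :: "'a manifold \<Rightarrow> 'a form \<Rightarrow> bool" where
  "multiadditive N f \<longleftrightarrow>
     (\<forall>As Bs. \<forall>X\<in>vector_fields N. \<forall>Y\<in>vector_fields N.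
        f (As @ (X + Y) # Bs) = f (As @ X # Bs) + f (As @ Y # Bs))"

lemma alternating_smooth: "alternating N f \<Longrightarrow> f Xs \<in> smooth_functions N"
  by (simp add: alternating_def)

lemma alternating_support: "alternating N f \<Longrightarrow> \<not> set Xs \<subseteq> vector_fields N \<Longrightarrow> f Xs = 0"
  unfolding alternating_def by blast

lemma alternating_swap: "alternating N f \<Longrightarrow> f (As @ X # Y # Bs) = - f (As @ Y # X # Bs)"
  unfolding alternating_def by blast

lemma alternating_swap_head: "alternating N f \<Longrightarrow> f (X # Y # Bs) = - f (Y # X # Bs)"
  using alternating_swap[of N f "[]" X Y Bs] by simp

lemma alternatingI:
  assumes "\<And>Xs. f Xs \<in> smooth_functions N"
    and "\<And>Xs. \<not> set Xs \<subseteq> vector_fields N \<Longrightarrow> f Xs = 0"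
    and "\<And>As X Y Bs. f (As @ X # Y # Bs) = - f (As @ Y # X # Bs)"
  shows "alternating N f"
  unfolding alternating_def using assms by blast

lemma alternating_insertion:
  assumes "alternating N f"
  shows "alternating N (insertion Z f)"
proof (rule alternatingI)
  fix Xs
  show "insertion Z f Xs \<in> smooth_functions N"
    unfolding insertion_def by (rule alternating_smooth[OF assms])
  show "insertion Z f Xs = 0" if "\<not> set Xs \<subseteq> vector_fields N"
    unfolding insertion_def by (rule alternating_support[OF assms]) (use that in auto)
next
  fix As X Y Bs
  show "insertion Z f (As @ X # Y # Bs) = - insertion Z f (As @ Y # X # Bs)"
    unfolding insertion_def using alternating_swap[OF assms, of "Z # As" X Y Bs] by simp
qed

lemma alternating_add:
  assumes "alternating N f" "alternating N g"
  shows "alternating N (f + g)"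
proof (rule alternatingI)
  fix Xs
  show "(f + g) Xs \<in> smooth_functions N"
    unfolding plus_fun_apply[of f g Xs]
    by (intro smooth_functions_add alternating_smooth[OF assms(1)] alternating_smooth[OF assms(2)])
  show "(f + g) Xs = 0" if "\<not> set Xs \<subseteq> vector_fields N"
    using alternating_support[OF assms(1) that] alternating_support[OF assms(2) that] by simp
next
  fix As X Y Bs
  show "(f + g) (As @ X # Y # Bs) = - (f + g) (As @ Y # X # Bs)"
    using alternating_swap[OF assms(1), of As X Y Bs] alternating_swap[OF assms(2), of As X Y Bs]
    by simp
qed

lemma multiadditive_head:
  assumes "multiadditive N f" "X \<in> vector_fields N" "Y \<in> vector_fields N"
  shows "f ((X + Y) # Bs) = f (X # Bs) + f (Y # Bs)"
proof -
  have "f ([] @ (X + Y) # Bs) = f ([] @ X # Bs) + f ([] @ Y # Bs)"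
    using assms unfolding multiadditive_def by blast
  then show ?thesis by simp
qed

lemma multiadditive_insertion:
  assumes "multiadditive N f"
  shows "multiadditive N (insertion Z f)"
  unfolding multiadditive_def insertion_def
proof (intro allI ballI)
  fix As Bs X Y
  assume "X \<in> vector_fields N" "Y \<in> vector_fields N"
  then have "f ((Z # As) @ (X + Y) # Bs) = f ((Z # As) @ X # Bs) + f ((Z # As) @ Y # Bs)"
    using assms unfolding multiadditive_def by blast
  then show "f (Z # As @ (X + Y) # Bs) = f (Z # As @ X # Bs) + f (Z # As @ Y # Bs)"
    by simp
qed

lemma insertion_apply: "insertion Z f Xs = f (Z # Xs)"
  by (simp add: insertion_def)

lemma insertion_add: "insertion Z (f + g) = insertion Z f + insertion Z g"
  by (simp add: insertion_def fun_eq_iff)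

lemma insertion_swap:
  assumes "alternating N f"
  shows "insertion X (insertion Y f) = - insertion Y (insertion X f)"
proof
  fix Xs
  show "insertion X (insertion Y f) Xs = (- insertion Y (insertion X f)) Xs"
    using alternating_swap_head[OF assms, of Y X Xs] by (simp add: insertion_def)
qed

lemma alternating_move:
  "alternating N f \<Longrightarrow> f (Z # As @ Bs) = (-1) ^ length As * f (As @ Z # Bs)"
proof (induction As arbitrary: f)
  case (Cons A As)
  have "f (Z # A # As @ Bs) = - insertion A f (Z # As @ Bs)"
    using alternating_swap_head[OF Cons.prems, of Z A] by (simp add: insertion_def)
  also have "\<dots> = - ((-1) ^ length As * insertion A f (As @ Z # Bs))"
    by (simp only: Cons.IH[OF alternating_insertion[OF Cons.prems]])
  finally show ?case
    by (simp only: insertion_def length_Cons append_Cons power_Suc mult.assoc mult_1_left mult_minus_left)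
qed simp

text \<open>
  Moving the bracket term of the exterior derivative from the head of the list to place j absorbs
  its sign. This identifies these terms with those of the Lie derivative.
\<close>

lemma alternating_move_update:
  assumes "alternating N f" "j < length Xs"
  shows "(-1) ^ j * f (Z # omit j Xs) = f (Xs[j := Z])"
proof -
  have "f (Z # omit j Xs) = (-1) ^ j * f (take j Xs @ Z # drop (Suc j) Xs)"
    using alternating_move[OF assms(1), of Z "take j Xs" "drop (Suc j) Xs"] assms(2)
    by (simp add: omit_def)
  moreover have "(-1) ^ j * (-1) ^ j = (1 :: 'a \<Rightarrow> real)"
    by (simp flip: power_mult_distrib)
  ultimately show ?thesis
    using assms(2) by (simp add: upd_conv_take_nth_drop flip: mult.assoc)
qed

lemma omit_Cons_0: "omit 0 (X # Xs) = Xs"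
  and omit_Cons_Suc: "omit (Suc i) (X # Xs) = X # omit i Xs"
  by (simp_all add: omit_def)

lemma ext_deriv_Nil: "ext_deriv N f [] = 0"
  by (simp add: ext_deriv_def)

lemma ext_deriv_support: "\<not> set Xs \<subseteq> vector_fields N \<Longrightarrow> ext_deriv N f Xs = 0"
  by (auto simp: ext_deriv_def)

lemma lie_deriv_support: "\<not> set Xs \<subseteq> vector_fields N \<Longrightarrow> lie_deriv N X f Xs = 0"
  by (auto simp: lie_deriv_def)

lemma lie_deriv_Nil: "lie_deriv N X f [] = X (f [])"
  by (simp add: lie_deriv_def)

text \<open>
  The rule \<open>i\<^sub>Z L\<^sub>X = L\<^sub>X i\<^sub>Z - i\<^bsub>[X,Z]\<^esub>\<close> evaluated on a list; it serves as a recursion for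
  the Lie derivative along the argument list.
\<close>

lemma lie_deriv_Cons:
  assumes "Z \<in> vector_fields N" "set Xs \<subseteq> vector_fields N"
  shows "lie_deriv N X f (Z # Xs) = lie_deriv N X (insertion Z f) Xs - f (vf_bracket X Z # Xs)"
  using assms by (simp add: lie_deriv_def insertion_def fun_eq_iff sum.lessThan_Suc_shift del: sum.lessThan_Suc)

lemma insertion_lie_deriv:
  assumes "alternating N f" "Z \<in> vector_fields N"
  shows "insertion Z (lie_deriv N X f) = lie_deriv N X (insertion Z f) - insertion (vf_bracket X Z) f"
proof
  fix Xs
  show "insertion Z (lie_deriv N X f) Xs =
      (lie_deriv N X (insertion Z f) - insertion (vf_bracket X Z) f) Xs"
    using assms
    by (cases "set Xs \<subseteq> vector_fields N")
      (simp_all add: fun_eq_iff insertion_apply lie_deriv_Cons lie_deriv_support alternating_support[OF assms(1)])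
qed

lemma lie_deriv_add:
  assumes "X \<in> vector_fields N" "alternating N f" "alternating N g"
  shows "lie_deriv N X (f + g) = lie_deriv N X f + lie_deriv N X g"
  using assms by (auto simp: lie_deriv_def vf_add[OF assms(1)] alternating_smooth[OF assms(2)]
      alternating_smooth[OF assms(3)] sum.distrib)

lemma lie_deriv_uminus:
  assumes "X \<in> vector_fields N" "alternating N f"
  shows "lie_deriv N X (- f) = - lie_deriv N X f"
  using assms by (auto simp: lie_deriv_def vf_uminus[OF assms(1)] alternating_smooth[OF assms(2)] sum_negf)

lemma ext_deriv_add:
  assumes "alternating N f" "alternating N g"
  shows "ext_deriv N (f + g) = ext_deriv N f + ext_deriv N g"
proof
  fix Xs
  show "ext_deriv N (f + g) Xs = (ext_deriv N f + ext_deriv N g) Xs"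
  proof (cases "set Xs \<subseteq> vector_fields N")
    case True
    have "(Xs ! i) (f Ys + g Ys) = (Xs ! i) (f Ys) + (Xs ! i) (g Ys)"
      if "i < length Xs" for i Ys
      using True nth_mem[OF that]
      by (intro vf_add[of _ N] alternating_smooth[OF assms(1)] alternating_smooth[OF assms(2)]) blast
    then show ?thesis
      using True by (simp add: ext_deriv_def sum.distrib distrib_left algebra_simps)
  qed (simp add: ext_deriv_support)
qed

text \<open>
  Cartan's formula \<open>i\<^sub>X d = L\<^sub>X - d i\<^sub>X\<close>, again as a recursion. In the invariant formula for d,
  the terms in which the first argument X acts or is bracketed make up \<open>L\<^sub>X\<close>, and those in
  which X is only carried along make up \<open>- d i\<^sub>X\<close>.
\<close>

lemma ext_deriv_Cons:
  assumes "alternating N f" "X \<in> vector_fields N" "set Xs \<subseteq> vector_fields N"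
  shows "ext_deriv N f (X # Xs) = lie_deriv N X f Xs - ext_deriv N (insertion X f) Xs"
proof -
  define n where "n = length Xs"
  define A where "A = (\<Sum>i<n. (-1) ^ i * (Xs ! i) (f (X # omit i Xs)))"
  define B where "B = (\<Sum>j<n. \<Sum>i<j. (-1) ^ (i + j) *
      f (X # vf_bracket (Xs ! i) (Xs ! j) # omit i (omit j Xs)))"
  have "(\<Sum>i<Suc n. (-1) ^ i * ((X # Xs) ! i) (f (omit i (X # Xs)))) = X (f Xs) - A"
    by (simp add: sum.lessThan_Suc_shift omit_Cons_0 omit_Cons_Suc A_def sum_negf del: sum.lessThan_Suc)
  moreover have "(\<Sum>j<Suc n. \<Sum>i<j. (-1) ^ (i + j) *
      f (vf_bracket ((X # Xs) ! i) ((X # Xs) ! j) # omit i (omit j (X # Xs))))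
    = - (\<Sum>i<n. f (Xs[i := vf_bracket X (Xs ! i)])) - B"
  proof -
    \<comment> \<open>Place j of Xs is place j + 1 of X # Xs. The summand i = 0 pairs it with X, the others do not involve X.\<close>
    have "(\<Sum>i<Suc j. (-1) ^ (i + Suc j) *
        f (vf_bracket ((X # Xs) ! i) ((X # Xs) ! Suc j) # omit i (omit (Suc j) (X # Xs))))
      = - f (Xs[j := vf_bracket X (Xs ! j)]) - (\<Sum>i<j. (-1) ^ (i + j) *
      f (X # vf_bracket (Xs ! i) (Xs ! j) # omit i (omit j Xs)))" if "j < n" for j
    proof -
      have "f (vf_bracket (Xs ! i) (Xs ! j) # X # omit i (omit j Xs))
          = - f (X # vf_bracket (Xs ! i) (Xs ! j) # omit i (omit j Xs))" for i
        by (rule alternating_swap_head[OF assms(1)])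
      moreover have "(-1) ^ j * f (vf_bracket X (Xs ! j) # omit j Xs)
          = f (Xs[j := vf_bracket X (Xs ! j)])"
        using alternating_move_update[OF assms(1)] that by (simp add: n_def)
      ultimately show ?thesis
        by (simp add: sum.lessThan_Suc_shift omit_Cons_0 omit_Cons_Suc sum_negf del: sum.lessThan_Suc)
    qed
    then show ?thesis
      by (simp add: sum.lessThan_Suc_shift[of _ n] B_def sum_subtractf sum_negf del: sum.lessThan_Suc)
  qed
  ultimately show ?thesis
    using assms(2,3)
    by (simp add: ext_deriv_def lie_deriv_def insertion_apply A_def B_def n_def del: sum.lessThan_Suc)
qed

lemma insertion_ext_deriv:
  assumes "alternating N f" "X \<in> vector_fields N"
  shows "insertion X (ext_deriv N f) = lie_deriv N X f - ext_deriv N (insertion X f)"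
proof
  fix Xs
  show "insertion X (ext_deriv N f) Xs = (lie_deriv N X f - ext_deriv N (insertion X f)) Xs"
    using assms
    by (cases "set Xs \<subseteq> vector_fields N")
      (simp_all add: fun_eq_iff insertion_apply ext_deriv_Cons lie_deriv_support ext_deriv_support)
qed

context
  fixes N :: "'a manifold"
  assumes N: "smooth_manifold N"
begin

lemma alternating_zero: "alternating N 0"
  by (rule alternatingI) (simp_all add: smooth_functions_zero[OF N])

lemma alternating_uminus:
  assumes "alternating N f"
  shows "alternating N (- f)"
proof (rule alternatingI)
  fix Xs
  show "(- f) Xs \<in> smooth_functions N"
    using smooth_functions_uminus[OF N alternating_smooth[OF assms, of Xs]] by simp
  show "(- f) Xs = 0" if "\<not> set Xs \<subseteq> vector_fields N"
    using alternating_support[OF assms that] by simp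
next
  fix As X Y Bs
  show "(- f) (As @ X # Y # Bs) = - (- f) (As @ Y # X # Bs)"
    using alternating_swap[OF assms, of As X Y Bs] by simp
qed

lemma alternating_diff: "alternating N f \<Longrightarrow> alternating N g \<Longrightarrow> alternating N (f - g)"
  using alternating_add[of N f "- g"] alternating_uminus by simp

lemma lie_deriv_diff:
  assumes "X \<in> vector_fields N" "alternating N f" "alternating N g"
  shows "lie_deriv N X (f - g) = lie_deriv N X f - lie_deriv N X g"
  using lie_deriv_add[OF assms(1,2) alternating_uminus[OF assms(3)]] lie_deriv_uminus[OF assms(1,3)]
  by simp

lemma ext_deriv_zero: "ext_deriv N 0 = 0"
  using ext_deriv_add[OF alternating_zero alternating_zero] by simp

lemma ext_deriv_diff:
  assumes "alternating N f" "alternating N g"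
  shows "ext_deriv N (f - g) = ext_deriv N f - ext_deriv N g"
  using ext_deriv_add[OF alternating_diff[OF assms] assms(2)] by (simp add: algebra_simps)

lemma lie_deriv_smooth:
  assumes "X \<in> vector_fields N" "alternating N f"
  shows "lie_deriv N X f Xs \<in> smooth_functions N"
  using assms(2)
proof (induction Xs arbitrary: f)
  case Nil
  show ?case
    unfolding lie_deriv_Nil by (intro vf_smooth[OF assms(1)] alternating_smooth[OF Nil])
next
  case (Cons Z Xs)
  show ?case
  proof (cases "set (Z # Xs) \<subseteq> vector_fields N")
    case True
    then show ?thesis
      using Cons.IH[OF alternating_insertion[OF Cons.prems]]
        alternating_smooth[OF Cons.prems]
      by (auto simp only: lie_deriv_Cons list.set insert_subset intro!: smooth_functions_diff[OF N])
  qed (simp only: lie_deriv_support smooth_functions_zero[OF N] not_False_eq_True)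
qed

text \<open>
  The Lie derivative is natural, so it respects the symmetries of f. By the recursion, only a swap
  of the first two arguments has to be examined.
\<close>

lemma lie_deriv_swap:
  assumes "X \<in> vector_fields N" "alternating N f" "set (As @ A # B # Bs) \<subseteq> vector_fields N"
  shows "lie_deriv N X f (As @ A # B # Bs) = - lie_deriv N X f (As @ B # A # Bs)"
  using assms(2,3)
proof (induction As arbitrary: f)
  case Nil
  have *: "lie_deriv N X f (A # B # Bs) = lie_deriv N X (insertion B (insertion A f)) Bs
      - f (A # vf_bracket X B # Bs) - f (vf_bracket X A # B # Bs)"
    if "A \<in> vector_fields N" "B \<in> vector_fields N" for A B
    using Nil that by (simp add: lie_deriv_Cons insertion_apply)
  have swap: "lie_deriv N X (insertion B (insertion A f)) Bs
      = - lie_deriv N X (insertion A (insertion B f)) Bs"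
    using insertion_swap[OF Nil(1), of B A] Nil(1)
    by (simp add: lie_deriv_uminus[OF assms(1)] alternating_insertion)
  have AB: "A \<in> vector_fields N" "B \<in> vector_fields N"
    using Nil(2) by auto
  show ?case
    unfolding append_Nil *[OF AB] *[OF AB(2,1)] swap
      alternating_swap_head[OF Nil(1), of A "vf_bracket X B" Bs]
      alternating_swap_head[OF Nil(1), of B "vf_bracket X A" Bs]
    by (rule ext) simp
next
  case (Cons Z As)
  have swap: "f (vf_bracket X Z # As @ A # B # Bs) = - f (vf_bracket X Z # As @ B # A # Bs)"
    using alternating_swap[OF Cons.prems(1), of "vf_bracket X Z # As" A B Bs] by simp
  have IH: "lie_deriv N X (insertion Z f) (As @ A # B # Bs)
      = - lie_deriv N X (insertion Z f) (As @ B # A # Bs)"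
    using Cons.prems by (intro Cons.IH alternating_insertion) auto
  have fields: "Z \<in> vector_fields N" "set (As @ A # B # Bs) \<subseteq> vector_fields N"
      "set (As @ B # A # Bs) \<subseteq> vector_fields N"
    using Cons.prems(2) by auto
  show ?case
    unfolding append_Cons lie_deriv_Cons[OF fields(1,2)] lie_deriv_Cons[OF fields(1,3)] swap IH
    by (rule ext) simp
qed

lemma alternating_lie_deriv:
  assumes "X \<in> vector_fields N" "alternating N f"
  shows "alternating N (lie_deriv N X f)"
proof -
  have "lie_deriv N X f (As @ A # B # Bs) = - lie_deriv N X f (As @ B # A # Bs)" for As A B Bs
  proof (cases "set (As @ A # B # Bs) \<subseteq> vector_fields N")
    case False
    then show ?thesis
      by (subst (1 2) lie_deriv_support) auto
  qed (rule lie_deriv_swap[OF assms])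
  then show ?thesis
    by (intro alternatingI lie_deriv_smooth[OF assms] lie_deriv_support)
qed

text \<open>
  Unfolding the first argument Z on both sides, the mixed terms \<open>- L\<^sub>X i\<^bsub>[Y,Z]\<^esub> - L\<^sub>Y i\<^bsub>[X,Z]\<^esub>\<close> are
  symmetric in X and Y and cancel; what remains is the Jacobi identity for X, Y, Z and the
  statement for \<open>i\<^sub>Z f\<close>.
\<close>

lemma lie_deriv_bracket:
  assumes "X \<in> vector_fields N" "Y \<in> vector_fields N" "alternating N f" "multiadditive N f"
  shows "lie_deriv N (vf_bracket X Y) f =
    lie_deriv N X (lie_deriv N Y f) - lie_deriv N Y (lie_deriv N X f)"
proof
  fix Xs
  show "lie_deriv N (vf_bracket X Y) f Xs =
    (lie_deriv N X (lie_deriv N Y f) - lie_deriv N Y (lie_deriv N X f)) Xs"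
    using assms(3,4)
  proof (induction Xs arbitrary: f)
    case Nil
    then show ?case
      by (simp add: lie_deriv_Nil vf_bracket_def)
  next
    case (Cons Z Xs)
    show ?case
    proof (cases "set (Z # Xs) \<subseteq> vector_fields N")
      case True
      then have Z: "Z \<in> vector_fields N" and Xs: "set Xs \<subseteq> vector_fields N"
        by auto
      have twice: "lie_deriv N A (lie_deriv N B f) (Z # Xs) =
          lie_deriv N A (lie_deriv N B (insertion Z f)) Xs
          - lie_deriv N A (insertion (vf_bracket B Z) f) Xs
          - lie_deriv N B (insertion (vf_bracket A Z) f) Xs
          + f (vf_bracket B (vf_bracket A Z) # Xs)"
        if "A \<in> vector_fields N" "B \<in> vector_fields N" for A B
      proof -
        have "lie_deriv N A (insertion Z (lie_deriv N B f)) =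
            lie_deriv N A (lie_deriv N B (insertion Z f)) - lie_deriv N A (insertion (vf_bracket B Z) f)"
          using Cons.prems(1) Z that
          by (simp add: insertion_lie_deriv lie_deriv_diff alternating_insertion alternating_lie_deriv)
        then show ?thesis
          using Z Xs that vector_fields_bracket[OF N that(1) Z]
          by (simp add: lie_deriv_Cons)
      qed
      have "f (vf_bracket X (vf_bracket Y Z) # Xs) =
          f (vf_bracket (vf_bracket X Y) Z # Xs) + f (vf_bracket Y (vf_bracket X Z) # Xs)"
        unfolding vf_bracket_jacobi[OF N assms(1,2) Z]
        by (intro multiadditive_head[OF Cons.prems(2)] vector_fields_bracket[OF N] assms(1,2) Z)
      moreover have "lie_deriv N (vf_bracket X Y) (insertion Z f) Xs =
        (lie_deriv N X (lie_deriv N Y (insertion Z f)) - lie_deriv N Y (lie_deriv N X (insertion Z f))) Xs"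
        by (rule Cons.IH) (use Cons.prems in \<open>simp_all add: alternating_insertion multiadditive_insertion\<close>)
      ultimately show ?thesis
        unfolding minus_apply[of _ _ "Z # Xs"] twice[OF assms(1,2)] twice[OF assms(2,1)]
        unfolding lie_deriv_Cons[OF Z Xs]
        by (simp add: fun_eq_iff)
    qed (simp add: lie_deriv_support)
  qed
qed

lemma ext_deriv_smooth:
  "alternating N f \<Longrightarrow> ext_deriv N f Xs \<in> smooth_functions N"
proof (induction Xs arbitrary: f)
  case Nil
  show ?case
    unfolding ext_deriv_Nil by (rule smooth_functions_zero[OF N])
next
  case (Cons Z Xs)
  show ?case
  proof (cases "set (Z # Xs) \<subseteq> vector_fields N")
    case True
    then show ?thesis
      using Cons.IH[OF alternating_insertion[OF Cons.prems]] Cons.prems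
      by (auto simp only: ext_deriv_Cons list.set insert_subset
          intro!: smooth_functions_diff[OF N] lie_deriv_smooth)
  qed (simp only: ext_deriv_support smooth_functions_zero[OF N] not_False_eq_True)
qed

lemma multiadditive_bracket_flip:
  assumes "multiadditive N f" "X \<in> vector_fields N" "Y \<in> vector_fields N"
  shows "f (vf_bracket X Y # Xs) = - f (vf_bracket Y X # Xs)"
proof -
  have "f (0 # Xs) = 0"
    using multiadditive_head[OF assms(1), of 0 0 Xs] vector_fields_zero[OF N] by simp
  then show ?thesis
    using multiadditive_head[OF assms(1), of "vf_bracket X Y" "vf_bracket Y X" Xs]
      vector_fields_bracket[OF N] assms(2,3)
    by (simp add: vf_bracket_sum_flip eq_neg_iff_add_eq_0)
qed

text \<open>
  Using Cartan's formula twice,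
  \<open>i\<^sub>B i\<^sub>A d = (L\<^sub>A i\<^sub>B - L\<^sub>B i\<^sub>A) - i\<^bsub>[A,B]\<^esub> + d i\<^sub>B i\<^sub>A\<close>, and each of the three parts is skew
  in A and B.
\<close>

lemma ext_deriv_swap:
  assumes "alternating N f" "multiadditive N f" "set (As @ A # B # Bs) \<subseteq> vector_fields N"
  shows "ext_deriv N f (As @ A # B # Bs) = - ext_deriv N f (As @ B # A # Bs)"
  using assms
proof (induction As arbitrary: f)
  case Nil
  have *: "ext_deriv N f (A # B # Bs) = lie_deriv N A (insertion B f) Bs
      - f (vf_bracket A B # Bs) - lie_deriv N B (insertion A f) Bs
      + ext_deriv N (insertion B (insertion A f)) Bs"
    if "A \<in> vector_fields N" "B \<in> vector_fields N" for A B
    using Nil that by (simp add: lie_deriv_Cons ext_deriv_Cons alternating_insertion)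
  have swap: "ext_deriv N (insertion B (insertion A f)) = - ext_deriv N (insertion A (insertion B f))"
    using insertion_swap[OF Nil(1), of B A] Nil(1)
      ext_deriv_diff[OF alternating_zero, of "insertion A (insertion B f)"]
    by (simp add: alternating_insertion ext_deriv_zero)
  have AB: "A \<in> vector_fields N" "B \<in> vector_fields N"
    using Nil(3) by auto
  show ?case
    unfolding append_Nil *[OF AB] *[OF AB(2,1)] swap multiadditive_bracket_flip[OF Nil(2) AB]
    by (rule ext) simp
next
  case (Cons Z As)
  have IH: "ext_deriv N (insertion Z f) (As @ A # B # Bs)
      = - ext_deriv N (insertion Z f) (As @ B # A # Bs)"
    using Cons.prems by (intro Cons.IH alternating_insertion multiadditive_insertion) auto
  have swap: "lie_deriv N Z f (As @ A # B # Bs) = - lie_deriv N Z f (As @ B # A # Bs)"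
    by (rule lie_deriv_swap) (use Cons.prems in auto)
  have fields: "Z \<in> vector_fields N" "set (As @ A # B # Bs) \<subseteq> vector_fields N"
      "set (As @ B # A # Bs) \<subseteq> vector_fields N"
    using Cons.prems(3) by auto
  show ?case
    unfolding append_Cons ext_deriv_Cons[OF Cons.prems(1) fields(1,2)]
      ext_deriv_Cons[OF Cons.prems(1) fields(1,3)] swap IH
    by (rule ext) simp
qed

lemma alternating_ext_deriv:
  assumes "alternating N f" "multiadditive N f"
  shows "alternating N (ext_deriv N f)"
proof -
  have "ext_deriv N f (As @ A # B # Bs) = - ext_deriv N f (As @ B # A # Bs)" for As A B Bs
  proof (cases "set (As @ A # B # Bs) \<subseteq> vector_fields N")
    case False
    then show ?thesis
      by (subst (1 2) ext_deriv_support) auto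
  qed (rule ext_deriv_swap[OF assms])
  then show ?thesis
    by (intro alternatingI ext_deriv_smooth[OF assms(1)] ext_deriv_support)
qed

text \<open>
  With \<open>i\<^sub>Z d = L\<^sub>Z - d i\<^sub>Z\<close> the claim on the first argument Z reduces to
  \<open>[L\<^sub>X, L\<^sub>Z] = L\<^bsub>[X,Z]\<^esub>\<close> and to the claim for \<open>i\<^sub>Z f\<close>.
\<close>

lemma lie_deriv_ext_deriv:
  assumes "X \<in> vector_fields N" "alternating N f" "multiadditive N f"
  shows "lie_deriv N X (ext_deriv N f) = ext_deriv N (lie_deriv N X f)"
proof
  fix Xs
  show "lie_deriv N X (ext_deriv N f) Xs = ext_deriv N (lie_deriv N X f) Xs"
    using assms(2,3)
  proof (induction Xs arbitrary: f)
    case Nil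
    then show ?case
      by (simp add: lie_deriv_Nil ext_deriv_Nil vf_zero[OF N assms(1)])
  next
    case (Cons Z Xs)
    show ?case
    proof (cases "set (Z # Xs) \<subseteq> vector_fields N")
      case True
      then have Z: "Z \<in> vector_fields N" and Xs: "set Xs \<subseteq> vector_fields N"
        by auto
      note XZ = vector_fields_bracket[OF N assms(1) Z]
      note alt = Cons.prems(1) alternating_insertion alternating_lie_deriv
        alternating_ext_deriv multiadditive_insertion Cons.prems(2)
      have "lie_deriv N X (ext_deriv N f) (Z # Xs) =
          lie_deriv N X (insertion Z (ext_deriv N f)) Xs - ext_deriv N f (vf_bracket X Z # Xs)"
        using Z Xs by (simp add: lie_deriv_Cons)
      also have "lie_deriv N X (insertion Z (ext_deriv N f)) Xs =
          lie_deriv N X (lie_deriv N Z f) Xs - lie_deriv N X (ext_deriv N (insertion Z f)) Xs"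
        using Z assms(1) by (simp add: insertion_ext_deriv lie_deriv_diff alt)
      also have "lie_deriv N X (ext_deriv N (insertion Z f)) Xs =
          ext_deriv N (lie_deriv N X (insertion Z f)) Xs"
        by (rule Cons.IH) (simp_all add: alt)
      also have "ext_deriv N f (vf_bracket X Z # Xs) =
          lie_deriv N X (lie_deriv N Z f) Xs - lie_deriv N Z (lie_deriv N X f) Xs
          - ext_deriv N (insertion (vf_bracket X Z) f) Xs"
        using Xs XZ Z assms(1) by (simp add: ext_deriv_Cons lie_deriv_bracket alt)
      finally have "lie_deriv N X (ext_deriv N f) (Z # Xs) = lie_deriv N Z (lie_deriv N X f) Xs
          - ext_deriv N (lie_deriv N X (insertion Z f) - insertion (vf_bracket X Z) f) Xs"
        by (simp add: ext_deriv_diff alt assms(1) fun_eq_iff)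
      also have "\<dots> = ext_deriv N (lie_deriv N X f) (Z # Xs)"
        using Z Xs assms(1) by (simp add: ext_deriv_Cons insertion_lie_deriv alt)
      finally show ?thesis .
    qed (simp add: lie_deriv_support ext_deriv_support)
  qed
qed

text \<open>
  As d commutes with \<open>L\<^sub>X\<close>, Cartan's formula gives \<open>i\<^sub>X d d f = d d i\<^sub>X f\<close>, which shortens the
  argument list.
\<close>

lemma ext_deriv_ext_deriv:
  assumes "alternating N f" "multiadditive N f"
  shows "ext_deriv N (ext_deriv N f) = 0"
proof
  fix Xs
  show "ext_deriv N (ext_deriv N f) Xs = 0 Xs"
    using assms
  proof (induction Xs arbitrary: f)
    case Nil
    then show ?case by (simp add: ext_deriv_Nil)
  next
    case (Cons X Xs)
    show ?case
    proof (cases "set (X # Xs) \<subseteq> vector_fields N")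
      case True
      note alt = Cons.prems alternating_insertion alternating_lie_deriv
        alternating_ext_deriv multiadditive_insertion
      have "ext_deriv N (ext_deriv N f) (X # Xs) = ext_deriv N (lie_deriv N X f) Xs
          - ext_deriv N (lie_deriv N X f - ext_deriv N (insertion X f)) Xs"
        using True by (simp add: ext_deriv_Cons insertion_ext_deriv lie_deriv_ext_deriv alt)
      also have "\<dots> = ext_deriv N (ext_deriv N (insertion X f)) Xs"
        using True by (simp add: ext_deriv_diff alt)
      also have "\<dots> = 0"
        using Cons.IH[of "insertion X f"] by (simp add: alt fun_eq_iff)
      finally show ?thesis by (simp add: fun_eq_iff)
    qed (simp add: ext_deriv_support fun_eq_iff)
  qed
qed

lemma alternating_scale:
  assumes "alternating N f"
  shows "alternating N (scale_form c f)"
proof (rule alternatingI)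
  fix Xs
  show "scale_form c f Xs \<in> smooth_functions N"
    unfolding scale_form_def by (rule smooth_functions_scale[OF N alternating_smooth[OF assms]])
  show "scale_form c f Xs = 0" if "\<not> set Xs \<subseteq> vector_fields N"
    unfolding scale_form_def alternating_support[OF assms that] by (rule ext) simp
next
  fix As X Y Bs
  show "scale_form c f (As @ X # Y # Bs) = - scale_form c f (As @ Y # X # Bs)"
    unfolding scale_form_def alternating_swap[OF assms, of As X Y Bs] by (rule ext) simp
qed

lemma insertion_scale: "insertion Z (scale_form c f) = scale_form c (insertion Z f)"
  by (simp only: insertion_def scale_form_def)

lemma lie_deriv_scale:
  assumes "X \<in> vector_fields N" "alternating N f"
  shows "lie_deriv N X (scale_form c f) = scale_form c (lie_deriv N X f)"
proof
  fix Xs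
  show "lie_deriv N X (scale_form c f) Xs = scale_form c (lie_deriv N X f) Xs"
    using assms(2)
  proof (induction Xs arbitrary: f)
    case Nil
    show ?case
      unfolding lie_deriv_Nil scale_form_def
      by (rule vf_scale[OF assms(1) alternating_smooth[OF Nil]])
  next
    case (Cons Z Xs)
    show ?case
    proof (cases "set (Z # Xs) \<subseteq> vector_fields N")
      case True
      then have Z: "Z \<in> vector_fields N" and Xs: "set Xs \<subseteq> vector_fields N"
        by auto
      have "lie_deriv N X (scale_form c f) (Z # Xs) =
          scale_form c (lie_deriv N X (insertion Z f)) Xs - scale_form c f (vf_bracket X Z # Xs)"
        unfolding lie_deriv_Cons[OF Z Xs] insertion_scale
          Cons.IH[OF alternating_insertion[OF Cons.prems]] ..
      also have "\<dots> = scale_form c (lie_deriv N X f) (Z # Xs)"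
        unfolding scale_form_def lie_deriv_Cons[OF Z Xs] by (rule ext) (simp add: algebra_simps)
      finally show ?thesis .
    next
      case False
      then show ?thesis
        unfolding scale_form_def by (simp only: lie_deriv_support not_False_eq_True) (simp add: fun_eq_iff)
    qed
  qed
qed

lemma ext_deriv_scale:
  assumes "alternating N f"
  shows "ext_deriv N (scale_form c f) = scale_form c (ext_deriv N f)"
proof
  fix Xs
  show "ext_deriv N (scale_form c f) Xs = scale_form c (ext_deriv N f) Xs"
    using assms
  proof (induction Xs arbitrary: f)
    case Nil
    show ?case
      unfolding ext_deriv_Nil scale_form_def by (rule ext) simp
  next
    case (Cons Z Xs)
    show ?case
    proof (cases "set (Z # Xs) \<subseteq> vector_fields N")
      case True
      then have Z: "Z \<in> vector_fields N" and Xs: "set Xs \<subseteq> vector_fields N"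
        by auto
      have "ext_deriv N (scale_form c f) (Z # Xs) =
          scale_form c (lie_deriv N Z f) Xs - scale_form c (ext_deriv N (insertion Z f)) Xs"
        unfolding ext_deriv_Cons[OF alternating_scale[OF Cons.prems] Z Xs] insertion_scale
          lie_deriv_scale[OF Z Cons.prems] Cons.IH[OF alternating_insertion[OF Cons.prems]] ..
      also have "\<dots> = scale_form c (ext_deriv N f) (Z # Xs)"
        unfolding scale_form_def ext_deriv_Cons[OF Cons.prems Z Xs]
        by (rule ext) (simp add: algebra_simps)
      finally show ?thesis .
    next
      case False
      then show ?thesis
        unfolding scale_form_def by (simp only: ext_deriv_support not_False_eq_True) (simp add: fun_eq_iff)
    qed
  qed
qed

end

section \<open>Differential forms\<close>

lemma formsD:
  assumes "\<omega> \<in> forms N k"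
  shows forms_support: "\<And>Xs. \<not> (set Xs \<subseteq> vector_fields N \<and> int (length Xs) = k) \<Longrightarrow> \<omega> Xs = 0"
    and forms_smooth: "\<And>Xs. \<omega> Xs \<in> smooth_functions N"
    and forms_add_arg: "\<And>As Bs X Y. X \<in> vector_fields N \<Longrightarrow> Y \<in> vector_fields N \<Longrightarrow>
      set As \<subseteq> vector_fields N \<Longrightarrow> set Bs \<subseteq> vector_fields N \<Longrightarrow>
      \<omega> (As @ (X + Y) # Bs) = \<omega> (As @ X # Bs) + \<omega> (As @ Y # Bs)"
    and forms_mult_arg: "\<And>As Bs f X. f \<in> smooth_functions N \<Longrightarrow> X \<in> vector_fields N \<Longrightarrow>
      set As \<subseteq> vector_fields N \<Longrightarrow> set Bs \<subseteq> vector_fields N \<Longrightarrow>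
      \<omega> (As @ (\<lambda>g. f * X g) # Bs) = f * \<omega> (As @ X # Bs)"
    and forms_repeated: "\<And>Xs. \<not> distinct Xs \<Longrightarrow> \<omega> Xs = 0"
  using assms unfolding forms_def mem_Collect_eq by blast+

lemma formsI:
  assumes "\<And>Xs. \<not> (set Xs \<subseteq> vector_fields N \<and> int (length Xs) = k) \<Longrightarrow> \<omega> Xs = 0"
    and "\<And>Xs. \<omega> Xs \<in> smooth_functions N"
    and "\<And>As Bs X Y. X \<in> vector_fields N \<Longrightarrow> Y \<in> vector_fields N \<Longrightarrow>
      set As \<subseteq> vector_fields N \<Longrightarrow> set Bs \<subseteq> vector_fields N \<Longrightarrow>
      \<omega> (As @ (X + Y) # Bs) = \<omega> (As @ X # Bs) + \<omega> (As @ Y # Bs)"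
    and "\<And>As Bs f X. f \<in> smooth_functions N \<Longrightarrow> X \<in> vector_fields N \<Longrightarrow>
      set As \<subseteq> vector_fields N \<Longrightarrow> set Bs \<subseteq> vector_fields N \<Longrightarrow>
      \<omega> (As @ (\<lambda>g. f * X g) # Bs) = f * \<omega> (As @ X # Bs)"
    and "\<And>Xs. \<not> distinct Xs \<Longrightarrow> \<omega> Xs = 0"
  shows "\<omega> \<in> forms N k"
  unfolding forms_def mem_Collect_eq by (intro conjI allI ballI impI assms)

lemma forms_multiadditive:
  assumes "\<omega> \<in> forms N k"
  shows "multiadditive N \<omega>"
  unfolding multiadditive_def
proof (intro allI ballI)
  fix As Bs X Y
  assume XY: "X \<in> vector_fields N" "Y \<in> vector_fields N"
  show "\<omega> (As @ (X + Y) # Bs) = \<omega> (As @ X # Bs) + \<omega> (As @ Y # Bs)"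
  proof (cases "set As \<subseteq> vector_fields N \<and> set Bs \<subseteq> vector_fields N")
    case False
    then have "\<not> set (As @ Z # Bs) \<subseteq> vector_fields N" for Z
      by auto
    then have "\<omega> (As @ Z # Bs) = 0" for Z
      using forms_support[OF assms] by blast
    then show ?thesis by simp
  qed (use forms_add_arg[OF assms XY] in blast)
qed

text \<open>
  Polarization: expand the value 0 of the form with \<open>X + Y\<close> in two adjacent places.
\<close>

lemma forms_alternating:
  assumes "\<omega> \<in> forms N k"
  shows "alternating N \<omega>"
proof (rule alternatingI)
  fix As X Y Bs
  show "\<omega> (As @ X # Y # Bs) = - \<omega> (As @ Y # X # Bs)"
  proof (cases "set (As @ X # Y # Bs) \<subseteq> vector_fields N")
    case True
    then have XY: "X \<in> vector_fields N" "Y \<in> vector_fields N"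
      by auto
    note add = forms_multiadditive[OF assms, unfolded multiadditive_def, rule_format]
    have repeated: "\<omega> (As @ Z # Z # Bs) = 0" for Z
      by (rule forms_repeated[OF assms]) simp
    have "0 = \<omega> (As @ X # (X + Y) # Bs) + \<omega> (As @ Y # (X + Y) # Bs)"
      using add[OF XY, of As "(X + Y) # Bs"] repeated[of "X + Y"] by simp
    also have "\<omega> (As @ X # (X + Y) # Bs) = \<omega> (As @ X # Y # Bs)"
      using add[OF XY, of "As @ [X]" Bs] repeated[of X] by simp
    also have "\<omega> (As @ Y # (X + Y) # Bs) = \<omega> (As @ Y # X # Bs)"
      using add[OF XY, of "As @ [Y]" Bs] repeated[of Y] by simp
    finally show ?thesis
      unfolding eq_neg_iff_add_eq_0 by (rule sym)
  next
    case False
    then have "\<omega> (As @ X # Y # Bs) = 0" "\<omega> (As @ Y # X # Bs) = 0"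
      by (auto intro!: forms_support[OF assms])
    then show ?thesis by simp
  qed
qed (use forms_support[OF assms] forms_smooth[OF assms] in blast)+

lemma forms_insertion:
  assumes "\<omega> \<in> forms N k" "Y \<in> vector_fields N"
  shows "insertion Y \<omega> \<in> forms N (k - 1)"
proof (rule formsI, unfold insertion_def)
  fix Xs
  show "\<omega> (Y # Xs) = 0" if "\<not> (set Xs \<subseteq> vector_fields N \<and> int (length Xs) = k - 1)"
    by (rule forms_support[OF assms(1)]) (use that in auto)
  show "\<omega> (Y # Xs) \<in> smooth_functions N"
    by (rule forms_smooth[OF assms(1)])
  show "\<omega> (Y # Xs) = 0" if "\<not> distinct Xs"
    by (rule forms_repeated[OF assms(1)]) (use that in simp)
next
  fix As Bs X Z
  assume XZ: "X \<in> vector_fields N" "Z \<in> vector_fields N" "set As \<subseteq> vector_fields N"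
    "set Bs \<subseteq> vector_fields N"
  show "\<omega> (Y # As @ (X + Z) # Bs) = \<omega> (Y # As @ X # Bs) + \<omega> (Y # As @ Z # Bs)"
    using forms_add_arg[OF assms(1) XZ(1,2), of "Y # As" Bs] XZ(3,4) assms(2) by simp
next
  fix As Bs f X
  assume fX: "f \<in> smooth_functions N" "X \<in> vector_fields N" "set As \<subseteq> vector_fields N"
    "set Bs \<subseteq> vector_fields N"
  show "\<omega> (Y # As @ (\<lambda>g. f * X g) # Bs) = f * \<omega> (Y # As @ X # Bs)"
    using forms_mult_arg[OF assms(1) fX(1,2), of "Y # As" Bs] fX(3,4) assms(2) by simp
qed

lemma forms_zero: "smooth_manifold N \<Longrightarrow> 0 \<in> forms N k"
  by (rule formsI) (simp_all add: smooth_functions_zero)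

lemma forms_add:
  assumes "\<omega> \<in> forms N k" "\<eta> \<in> forms N k"
  shows "\<omega> + \<eta> \<in> forms N k"
proof (rule formsI)
  fix Xs
  show "(\<omega> + \<eta>) Xs = 0" if "\<not> (set Xs \<subseteq> vector_fields N \<and> int (length Xs) = k)"
    using forms_support[OF assms(1) that] forms_support[OF assms(2) that] by simp
  show "(\<omega> + \<eta>) Xs \<in> smooth_functions N"
    using smooth_functions_add[OF forms_smooth[OF assms(1)] forms_smooth[OF assms(2)], of Xs Xs]
    by simp
  show "(\<omega> + \<eta>) Xs = 0" if "\<not> distinct Xs"
    using forms_repeated[OF assms(1) that] forms_repeated[OF assms(2) that] by simp
next
  fix As Bs X Y
  assume "X \<in> vector_fields N" "Y \<in> vector_fields N" "set As \<subseteq> vector_fields N"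
    "set Bs \<subseteq> vector_fields N"
  note add = forms_add_arg[OF assms(1) this] forms_add_arg[OF assms(2) this]
  show "(\<omega> + \<eta>) (As @ (X + Y) # Bs) = (\<omega> + \<eta>) (As @ X # Bs) + (\<omega> + \<eta>) (As @ Y # Bs)"
    unfolding plus_fun_apply[of \<omega> \<eta>] add by (rule ext) simp
next
  fix As Bs f X
  assume "f \<in> smooth_functions N" "X \<in> vector_fields N" "set As \<subseteq> vector_fields N"
    "set Bs \<subseteq> vector_fields N"
  note mult = forms_mult_arg[OF assms(1) this] forms_mult_arg[OF assms(2) this]
  show "(\<omega> + \<eta>) (As @ (\<lambda>g. f * X g) # Bs) = f * (\<omega> + \<eta>) (As @ X # Bs)"
    unfolding plus_fun_apply[of \<omega> \<eta>] mult by (rule ext) (simp add: algebra_simps)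
qed

lemma forms_scale:
  assumes "smooth_manifold N" "\<omega> \<in> forms N k"
  shows "scale_form c \<omega> \<in> forms N k"
proof (rule formsI, unfold scale_form_def)
  fix Xs
  show "(\<lambda>x. c * \<omega> Xs x) = 0" if "\<not> (set Xs \<subseteq> vector_fields N \<and> int (length Xs) = k)"
    unfolding forms_support[OF assms(2) that] by (rule ext) simp
  show "(\<lambda>x. c * \<omega> Xs x) \<in> smooth_functions N"
    by (rule smooth_functions_scale[OF assms(1) forms_smooth[OF assms(2)]])
  show "(\<lambda>x. c * \<omega> Xs x) = 0" if "\<not> distinct Xs"
    unfolding forms_repeated[OF assms(2) that] by (rule ext) simp
next
  fix As Bs X Y
  assume "X \<in> vector_fields N" "Y \<in> vector_fields N" "set As \<subseteq> vector_fields N"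
    "set Bs \<subseteq> vector_fields N"
  note add = forms_add_arg[OF assms(2) this]
  show "(\<lambda>x. c * \<omega> (As @ (X + Y) # Bs) x)
      = (\<lambda>x. c * \<omega> (As @ X # Bs) x) + (\<lambda>x. c * \<omega> (As @ Y # Bs) x)"
    unfolding add by (rule ext) (simp add: algebra_simps)
next
  fix As Bs f X
  assume "f \<in> smooth_functions N" "X \<in> vector_fields N" "set As \<subseteq> vector_fields N"
    "set Bs \<subseteq> vector_fields N"
  note mult = forms_mult_arg[OF assms(2) this]
  show "(\<lambda>x. c * \<omega> (As @ (\<lambda>g. f * X g) # Bs) x) = f * (\<lambda>x. c * \<omega> (As @ X # Bs) x)"
    unfolding mult by (rule ext) (simp add: algebra_simps)
qed

lemma forms_insertion_zero:
  assumes "smooth_manifold N" "\<omega> \<in> forms N k"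
  shows "insertion 0 \<omega> = 0"
proof
  fix Xs
  show "insertion 0 \<omega> Xs = 0 Xs"
    using multiadditive_head[OF forms_multiadditive[OF assms(2)], of 0 0 Xs]
      vector_fields_zero[OF assms(1)]
    by (simp add: insertion_def)
qed

lemma forms_insertion_add:
  assumes "\<omega> \<in> forms N k" "X \<in> vector_fields N" "Y \<in> vector_fields N"
  shows "insertion (X + Y) \<omega> = insertion X \<omega> + insertion Y \<omega>"
proof
  fix Xs
  show "insertion (X + Y) \<omega> Xs = (insertion X \<omega> + insertion Y \<omega>) Xs"
    unfolding insertion_def plus_fun_apply[of _ _ Xs]
    by (rule multiadditive_head[OF forms_multiadditive[OF assms(1)] assms(2,3)])
qed

text \<open>
  Forms are linear over smooth functions, in particular over the constant ones.
\<close>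

lemma forms_insertion_scale:
  assumes "smooth_manifold N" "\<omega> \<in> forms N k" "X \<in> vector_fields N"
  shows "insertion (\<lambda>g x. c * X g x) \<omega> = scale_form c (insertion X \<omega>)"
proof
  fix Xs
  have field: "(\<lambda>g x. c * X g x) = (\<lambda>g. constant_fun N c * X g)"
  proof
    fix g
    have "X g \<in> smooth_functions N"
      using vf_smooth[OF assms(3)] vf_nonsmooth[OF assms(3)] smooth_functions_zero[OF assms(1)]
      by (cases "g \<in> smooth_functions N") auto
    then show "(\<lambda>x. c * X g x) = constant_fun N c * X g"
      by (rule constant_fun_mult[symmetric])
  qed
  show "insertion (\<lambda>g x. c * X g x) \<omega> Xs = scale_form c (insertion X \<omega>) Xs"
  proof (cases "set Xs \<subseteq> vector_fields N")
    case True
    have "\<omega> ([] @ (\<lambda>g. constant_fun N c * X g) # Xs) = constant_fun N c * \<omega> ([] @ X # Xs)"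
      by (rule forms_mult_arg[OF assms(2) constant_fun_smooth[OF assms(1)] assms(3)]) (use True in auto)
    then show ?thesis
      unfolding insertion_def scale_form_def field constant_fun_mult[OF forms_smooth[OF assms(2)]] by simp
  next
    case False
    then have "\<omega> (Z # Xs) = 0" for Z
      by (intro forms_support[OF assms(2)]) auto
    then show ?thesis
      unfolding insertion_def scale_form_def by (simp add: fun_eq_iff)
  qed
qed

section \<open>Vertical fields and horizontal forms\<close>

lemma vertical_fields_vf: "Y \<in> vertical_fields P M \<alpha> \<Longrightarrow> Y \<in> vector_fields P"
  by (simp add: vertical_fields_def)

lemma vertical_fields_zero: "smooth_manifold P \<Longrightarrow> 0 \<in> vertical_fields P M \<alpha>"
  by (simp add: vertical_fields_def vector_fields_zero)

lemma vertical_fields_add: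
  "X \<in> vertical_fields P M \<alpha> \<Longrightarrow> Y \<in> vertical_fields P M \<alpha> \<Longrightarrow> X + Y \<in> vertical_fields P M \<alpha>"
  by (simp add: vertical_fields_def vector_fields_add)

lemma vertical_fields_scale:
  "smooth_manifold P \<Longrightarrow> X \<in> vertical_fields P M \<alpha> \<Longrightarrow> (\<lambda>g x. c * X g x) \<in> vertical_fields P M \<alpha>"
  by (auto simp: vertical_fields_def vector_fields_scale fun_eq_iff)

lemma vertical_fields_bracket:
  assumes "smooth_manifold P" "X \<in> vertical_fields P M \<alpha>" "Y \<in> vertical_fields P M \<alpha>"
  shows "vf_bracket X Y \<in> vertical_fields P M \<alpha>"
proof -
  have "vf_bracket X Y (pullback P \<alpha> g) = 0" if "g \<in> smooth_functions M" for g
  proof -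
    have "X (pullback P \<alpha> g) = 0" "Y (pullback P \<alpha> g) = 0"
      using that assms(2,3) by (auto simp: vertical_fields_def)
    then show ?thesis
      using vf_zero[OF assms(1) vertical_fields_vf[OF assms(2)]]
        vf_zero[OF assms(1) vertical_fields_vf[OF assms(3)]]
      by (simp add: vf_bracket_def)
  qed
  then show ?thesis
    using vector_fields_bracket[OF assms(1) vertical_fields_vf[OF assms(2)] vertical_fields_vf[OF assms(3)]]
    by (simp add: vertical_fields_def)
qed

text \<open>
  The affine 0-forms are the horizontal (n-1)-forms. For n = 0 the degree is -1, and the
  condition on the degree already forces such a form to vanish.
\<close>

lemma Omega_0_iff:
  "f \<in> Omega P M \<alpha> 0 \<longleftrightarrow>
     f \<in> forms P (int (mdim M) - 1) \<and> (\<forall>Y\<in>vertical_fields P M \<alpha>. insertion Y f = 0)"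
proof -
  have "(\<forall>Ys. set Ys \<subseteq> vertical_fields P M \<alpha> \<longrightarrow> int (length Ys) = 1 \<longrightarrow> foldr insertion Ys f = 0)
      \<longleftrightarrow> (\<forall>Y\<in>vertical_fields P M \<alpha>. insertion Y f = 0)"
  proof safe
    fix Y assume "\<forall>Ys. set Ys \<subseteq> vertical_fields P M \<alpha> \<longrightarrow> int (length Ys) = 1 \<longrightarrow>
        foldr insertion Ys f = 0" "Y \<in> vertical_fields P M \<alpha>"
    then show "insertion Y f = 0"
      by (auto dest: spec[of _ "[Y]"])
  next
    fix Ys assume *: "\<forall>Y\<in>vertical_fields P M \<alpha>. insertion Y f = 0"
      "set Ys \<subseteq> vertical_fields P M \<alpha>" "int (length Ys) = 1"
    from *(3) have "length Ys = Suc 0" by simp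
    then obtain Y where "Ys = [Y]" by (auto simp: length_Suc_conv)
    with * show "foldr insertion Ys f = 0" by simp
  qed
  then show ?thesis
    by (simp add: Omega_def Lambda_def)
qed

lemma Omega_2D:
  assumes "\<omega> \<in> Omega P M \<alpha> 2"
  shows "\<omega> \<in> forms P (int (mdim M) + 1)"
    and "X \<in> vertical_fields P M \<alpha> \<Longrightarrow> Y \<in> vertical_fields P M \<alpha> \<Longrightarrow> Z \<in> vertical_fields P M \<alpha>
      \<Longrightarrow> insertion X (insertion Y (insertion Z \<omega>)) = 0"
proof -
  from assms have \<omega>: "\<omega> \<in> forms P (2 + int (mdim M) - 1)"
    and killed: "\<And>Ys. set Ys \<subseteq> vertical_fields P M \<alpha> \<Longrightarrow> int (length Ys) = 3
      \<Longrightarrow> foldr insertion Ys \<omega> = 0"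
    by (auto simp: Omega_def Lambda_def)
  from \<omega> show "\<omega> \<in> forms P (int (mdim M) + 1)"
    by (simp add: algebra_simps)
  show "insertion X (insertion Y (insertion Z \<omega>)) = 0"
    if "X \<in> vertical_fields P M \<alpha>" "Y \<in> vertical_fields P M \<alpha>" "Z \<in> vertical_fields P M \<alpha>"
    using killed[of "[X, Y, Z]"] that by simp
qed

section \<open>Noether symmetries and the bracket of currents\<close>

lemma pd_noetherD:
  assumes "pd_noether P M \<alpha> \<omega> Y f"
  shows "Y \<in> vertical_fields P M \<alpha>" "Y \<in> vector_fields P" "f \<in> forms P (int (mdim M) - 1)"
    "\<And>Z. Z \<in> vertical_fields P M \<alpha> \<Longrightarrow> insertion Z f = 0" "insertion Y \<omega> = ext_deriv P f"
    "alternating P f" "multiadditive P f"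
  using assms unfolding pd_noether_def Omega_0_iff
  by (auto intro: vertical_fields_vf forms_alternating forms_multiadditive)

lemma pd_noetherI:
  assumes "Y \<in> vertical_fields P M \<alpha>" "f \<in> forms P (int (mdim M) - 1)"
    "\<And>Z. Z \<in> vertical_fields P M \<alpha> \<Longrightarrow> insertion Z f = 0" "insertion Y \<omega> = ext_deriv P f"
  shows "pd_noether P M \<alpha> \<omega> Y f"
  unfolding pd_noether_def Omega_0_iff using assms by blast

context
  fixes P :: "'p manifold" and M :: "'m manifold" and \<alpha> :: "'p \<Rightarrow> 'm" and \<omega> :: "'p form"
  assumes P: "smooth_manifold P" and \<omega>: "pd_prehamiltonian P M \<alpha> \<omega>"
begin

lemma prehamiltonian_form: "\<omega> \<in> forms P (int (mdim M) + 1)"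
  using \<omega> Omega_2D(1) unfolding pd_prehamiltonian_def by blast

lemma noether_zero: "pd_noether P M \<alpha> \<omega> 0 0"
proof (rule pd_noetherI)
  show "insertion 0 \<omega> = ext_deriv P 0"
    using forms_insertion_zero[OF P prehamiltonian_form] ext_deriv_zero[OF P] by simp
  show "insertion Z 0 = 0" for Z :: "'p vfield"
    by (simp add: insertion_def fun_eq_iff)
qed (simp_all add: vertical_fields_zero[OF P] forms_zero[OF P])

lemma noether_add:
  assumes "pd_noether P M \<alpha> \<omega> Y f" "pd_noether P M \<alpha> \<omega> Z g"
  shows "pd_noether P M \<alpha> \<omega> (Y + Z) (f + g)"
proof (rule pd_noetherI)
  note Y = pd_noetherD[OF assms(1)] and Z = pd_noetherD[OF assms(2)]
  show "insertion (Y + Z) \<omega> = ext_deriv P (f + g)"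
    unfolding forms_insertion_add[OF prehamiltonian_form Y(2) Z(2)] ext_deriv_add[OF Y(6) Z(6)]
      Y(5) Z(5) ..
  show "insertion X (f + g) = 0" if "X \<in> vertical_fields P M \<alpha>" for X
    unfolding insertion_add Y(4)[OF that] Z(4)[OF that] by simp
qed (intro vertical_fields_add forms_add pd_noetherD[OF assms(1)] pd_noetherD[OF assms(2)])+

lemma noether_scale:
  assumes "pd_noether P M \<alpha> \<omega> Y f"
  shows "pd_noether P M \<alpha> \<omega> (\<lambda>g x. c * Y g x) (scale_form c f)"
proof (rule pd_noetherI)
  note Y = pd_noetherD[OF assms]
  show "insertion (\<lambda>g x. c * Y g x) \<omega> = ext_deriv P (scale_form c f)"
    unfolding forms_insertion_scale[OF P prehamiltonian_form Y(2)] ext_deriv_scale[OF P Y(6)]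
      Y(5) ..
  show "insertion X (scale_form c f) = 0" if "X \<in> vertical_fields P M \<alpha>" for X
    unfolding insertion_scale[OF P] Y(4)[OF that] by (simp add: scale_form_def fun_eq_iff)
qed (intro vertical_fields_scale[OF P] forms_scale[OF P] pd_noetherD[OF assms])+

text \<open>
  Horizontality of g removes the term \<open>d i\<^sub>Y g\<close> of Cartan's formula. The right-hand side is
  visibly a form, horizontal, and skew in Y and Z.
\<close>

lemma lie_deriv_current:
  assumes "Y \<in> vertical_fields P M \<alpha>" "pd_noether P M \<alpha> \<omega> Z g"
  shows "lie_deriv P Y g = insertion Y (insertion Z \<omega>)"
proof -
  note Z = pd_noetherD[OF assms(2)]
  have "insertion Y (ext_deriv P g) = lie_deriv P Y g - ext_deriv P (insertion Y g)"
    by (rule insertion_ext_deriv[OF Z(6) vertical_fields_vf[OF assms(1)]])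
  then show ?thesis
    unfolding Z(4)[OF assms(1)] Z(5) ext_deriv_zero[OF P] by simp
qed

lemma lie_deriv_current_skew:
  assumes "pd_noether P M \<alpha> \<omega> Y f" "pd_noether P M \<alpha> \<omega> Z g"
  shows "lie_deriv P Y g = - lie_deriv P Z f"
  unfolding lie_deriv_current[OF pd_noetherD(1)[OF assms(1)] assms(2)]
    lie_deriv_current[OF pd_noetherD(1)[OF assms(2)] assms(1)]
  by (rule insertion_swap[OF forms_alternating[OF prehamiltonian_form]])

text \<open>
  Infinitesimal symmetries preserve \<open>\<omega>\<close>: both terms of Cartan's formula vanish, one because
  \<open>\<omega>\<close> is closed, the other because \<open>i\<^sub>Y \<omega>\<close> is exact.
\<close>

lemma lie_deriv_symmetry_form:
  assumes "pd_noether P M \<alpha> \<omega> Y f"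
  shows "lie_deriv P Y \<omega> = 0"
proof -
  note Y = pd_noetherD[OF assms]
  have "insertion Y (ext_deriv P \<omega>) = lie_deriv P Y \<omega> - ext_deriv P (insertion Y \<omega>)"
    by (rule insertion_ext_deriv[OF forms_alternating[OF prehamiltonian_form] Y(2)])
  moreover have "insertion Y (ext_deriv P \<omega>) = 0"
    using \<omega> by (simp add: pd_prehamiltonian_def insertion_def fun_eq_iff)
  moreover have "ext_deriv P (insertion Y \<omega>) = 0"
    unfolding Y(5) by (rule ext_deriv_ext_deriv[OF P Y(6,7)])
  ultimately show ?thesis by simp
qed

text \<open>
  \<open>i\<^bsub>[Y,Z]\<^esub> \<omega> = L\<^sub>Y i\<^sub>Z \<omega> - i\<^sub>Z L\<^sub>Y \<omega>\<close>, where the last term vanishes and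
  \<open>L\<^sub>Y i\<^sub>Z \<omega> = L\<^sub>Y d g = d L\<^sub>Y g\<close>.
\<close>

lemma noether_bracket:
  assumes "pd_noether P M \<alpha> \<omega> Y f" "pd_noether P M \<alpha> \<omega> Z g"
  shows "pd_noether P M \<alpha> \<omega> (vf_bracket Y Z) (lie_deriv P Y g)"
proof (rule pd_noetherI)
  note Y = pd_noetherD[OF assms(1)] and Z = pd_noetherD[OF assms(2)]
  note current = lie_deriv_current[OF Y(1) assms(2)]
  show "lie_deriv P Y g \<in> forms P (int (mdim M) - 1)"
    unfolding current
    using forms_insertion[OF forms_insertion[OF prehamiltonian_form Z(2)] Y(2)] by simp
  show "insertion X (lie_deriv P Y g) = 0" if "X \<in> vertical_fields P M \<alpha>" for X
    unfolding current using \<omega> Omega_2D(2)[OF _ that Y(1) Z(1)]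
    unfolding pd_prehamiltonian_def by blast
  have "insertion Z (lie_deriv P Y \<omega>) = lie_deriv P Y (insertion Z \<omega>) - insertion (vf_bracket Y Z) \<omega>"
    by (rule insertion_lie_deriv[OF forms_alternating[OF prehamiltonian_form] Z(2)])
  moreover have "insertion Z (lie_deriv P Y \<omega>) = 0"
    unfolding lie_deriv_symmetry_form[OF assms(1)] by (simp add: insertion_def fun_eq_iff)
  moreover have "lie_deriv P Y (insertion Z \<omega>) = ext_deriv P (lie_deriv P Y g)"
    unfolding Z(5) by (rule lie_deriv_ext_deriv[OF P Y(2) Z(6,7)])
  ultimately show "insertion (vf_bracket Y Z) \<omega> = ext_deriv P (lie_deriv P Y g)"
    by simp
qed (rule vertical_fields_bracket[OF P pd_noetherD(1)[OF assms(1)] pd_noetherD(1)[OF assms(2)]])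

text \<open>
  By skewness \<open>L\<^sub>Y g = - L\<^sub>Z f\<close>, and the right-hand side does not mention Y; so any symmetry
  relative to f gives the same bracket as the chosen one.
\<close>

lemma current_bracket_eq:
  assumes "pd_noether P M \<alpha> \<omega> Y f" "g \<in> noether_currents P M \<alpha> \<omega>"
  shows "current_bracket P M \<alpha> \<omega> f g = lie_deriv P Y g"
proof -
  obtain Z where Z: "pd_noether P M \<alpha> \<omega> Z g"
    using assms(2) by (auto simp: noether_currents_def)
  have "pd_noether P M \<alpha> \<omega> (SOME Y. pd_noether P M \<alpha> \<omega> Y f) f"
    by (rule someI[of "\<lambda>Y. pd_noether P M \<alpha> \<omega> Y f", OF assms(1)])
  then show ?thesis
    unfolding current_bracket_def
    using lie_deriv_current_skew[OF _ Z] lie_deriv_current_skew[OF assms(1) Z] by simp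
qed

lemma current_bracket_skew:
  assumes "f \<in> noether_currents P M \<alpha> \<omega>" "g \<in> noether_currents P M \<alpha> \<omega>"
  shows "current_bracket P M \<alpha> \<omega> f g = - current_bracket P M \<alpha> \<omega> g f"
proof -
  obtain Y Z where "pd_noether P M \<alpha> \<omega> Y f" "pd_noether P M \<alpha> \<omega> Z g"
    using assms by (auto simp: noether_currents_def)
  then show ?thesis
    using current_bracket_eq assms lie_deriv_current_skew by metis
qed

lemma noether_currents_bracket:
  assumes "f \<in> noether_currents P M \<alpha> \<omega>" "g \<in> noether_currents P M \<alpha> \<omega>"
  shows "current_bracket P M \<alpha> \<omega> f g \<in> noether_currents P M \<alpha> \<omega>"
proof -
  obtain Y Z where *: "pd_noether P M \<alpha> \<omega> Y f" "pd_noether P M \<alpha> \<omega> Z g"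
    using assms by (auto simp: noether_currents_def)
  show ?thesis
    unfolding current_bracket_eq[OF *(1) assms(2)] noether_currents_def
    using noether_bracket[OF *] by blast
qed

lemma noether_currents_add:
  "f \<in> noether_currents P M \<alpha> \<omega> \<Longrightarrow> g \<in> noether_currents P M \<alpha> \<omega>
    \<Longrightarrow> f + g \<in> noether_currents P M \<alpha> \<omega>"
  unfolding noether_currents_def using noether_add by blast

lemma noether_currents_scale:
  "f \<in> noether_currents P M \<alpha> \<omega> \<Longrightarrow> scale_form c f \<in> noether_currents P M \<alpha> \<omega>"
  unfolding noether_currents_def using noether_scale by blast

lemma noether_currents_alternating:
  "f \<in> noether_currents P M \<alpha> \<omega> \<Longrightarrow> alternating P f"
  unfolding noether_currents_def using pd_noetherD(6) by blast

lemma current_bracket_add_right: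
  assumes "f \<in> noether_currents P M \<alpha> \<omega>" "g \<in> noether_currents P M \<alpha> \<omega>"
    and "h \<in> noether_currents P M \<alpha> \<omega>"
  shows "current_bracket P M \<alpha> \<omega> h (f + g) =
    current_bracket P M \<alpha> \<omega> h f + current_bracket P M \<alpha> \<omega> h g"
proof -
  obtain Y where Y: "pd_noether P M \<alpha> \<omega> Y h"
    using assms(3) by (auto simp: noether_currents_def)
  show ?thesis
    unfolding current_bracket_eq[OF Y assms(1)] current_bracket_eq[OF Y assms(2)]
      current_bracket_eq[OF Y noether_currents_add[OF assms(1,2)]]
    by (rule lie_deriv_add[OF pd_noetherD(2)[OF Y] assms(1,2)[THEN noether_currents_alternating]])
qed

lemma current_bracket_scale_right:
  assumes "f \<in> noether_currents P M \<alpha> \<omega>" "g \<in> noether_currents P M \<alpha> \<omega>"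
  shows "current_bracket P M \<alpha> \<omega> f (scale_form c g) = scale_form c (current_bracket P M \<alpha> \<omega> f g)"
proof -
  obtain Y where Y: "pd_noether P M \<alpha> \<omega> Y f"
    using assms(1) by (auto simp: noether_currents_def)
  show ?thesis
    unfolding current_bracket_eq[OF Y assms(2)]
      current_bracket_eq[OF Y noether_currents_scale[OF assms(2)]]
    by (rule lie_deriv_scale[OF P pd_noetherD(2)[OF Y] noether_currents_alternating[OF assms(2)]])
qed

text \<open>
  For symmetries X, Y relative to f, g, skewness brings h to the innermost place of each term, and
  the three terms become \<open>L\<^sub>X L\<^sub>Y h - L\<^sub>Y L\<^sub>X h - L\<^bsub>[X,Y]\<^esub> h = 0\<close>.
\<close>

lemma current_bracket_jacobi:
  assumes "f \<in> noether_currents P M \<alpha> \<omega>" "g \<in> noether_currents P M \<alpha> \<omega>"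
    and "h \<in> noether_currents P M \<alpha> \<omega>"
  shows "current_bracket P M \<alpha> \<omega> f (current_bracket P M \<alpha> \<omega> g h) +
    current_bracket P M \<alpha> \<omega> g (current_bracket P M \<alpha> \<omega> h f) +
    current_bracket P M \<alpha> \<omega> h (current_bracket P M \<alpha> \<omega> f g) = 0"
proof -
  obtain X Y Z where X: "pd_noether P M \<alpha> \<omega> X f" and Y: "pd_noether P M \<alpha> \<omega> Y g"
    and Z: "pd_noether P M \<alpha> \<omega> Z h"
    using assms by (auto simp: noether_currents_def)
  note vf = pd_noetherD(2)[OF X] pd_noetherD(2)[OF Y]
  have "current_bracket P M \<alpha> \<omega> f (current_bracket P M \<alpha> \<omega> g h) = lie_deriv P X (lie_deriv P Y h)"
    using current_bracket_eq[OF X noether_currents_bracket[OF assms(2,3)]]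
    by (simp only: current_bracket_eq[OF Y assms(3)])
  moreover have "current_bracket P M \<alpha> \<omega> g (current_bracket P M \<alpha> \<omega> h f)
      = - lie_deriv P Y (lie_deriv P X h)"
  proof -
    have "current_bracket P M \<alpha> \<omega> h f = - lie_deriv P X h"
      using current_bracket_skew[OF assms(3,1)] by (simp only: current_bracket_eq[OF X assms(3)])
    moreover have "alternating P (lie_deriv P X h)"
      by (rule alternating_lie_deriv[OF P vf(1) noether_currents_alternating[OF assms(3)]])
    ultimately show ?thesis
      using current_bracket_eq[OF Y noether_currents_bracket[OF assms(3,1)]] lie_deriv_uminus[OF vf(2)]
      by simp
  qed
  moreover have "current_bracket P M \<alpha> \<omega> h (current_bracket P M \<alpha> \<omega> f g)
      = - (lie_deriv P X (lie_deriv P Y h) - lie_deriv P Y (lie_deriv P X h))"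
  proof -
    have "current_bracket P M \<alpha> \<omega> h (current_bracket P M \<alpha> \<omega> f g)
        = - current_bracket P M \<alpha> \<omega> (lie_deriv P X g) h"
      using current_bracket_skew[OF assms(3) noether_currents_bracket[OF assms(1,2)]]
      by (simp only: current_bracket_eq[OF X assms(2)])
    then show ?thesis
      unfolding current_bracket_eq[OF noether_bracket[OF X Y] assms(3)]
        lie_deriv_bracket[OF P vf pd_noetherD(6,7)[OF Z]] .
  qed
  ultimately show ?thesis by simp
qed

end

theorem proposition6p4:
  fixes P :: "'p manifold" and M :: "'m manifold" and F :: "'f manifold"
    and \<alpha> :: "'p \<Rightarrow> 'm" and \<omega> :: "'p form"
  assumes "fiber_bundle P M F \<alpha>"
    and "connected_space (mtop F)"
    and "pd_prehamiltonian P M \<alpha> \<omega>"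
  shows "(\<forall>f1\<in>noether_currents P M \<alpha> \<omega>. \<forall>f2\<in>noether_currents P M \<alpha> \<omega>. \<forall>Y1.
            pd_noether P M \<alpha> \<omega> Y1 f1 \<longrightarrow> current_bracket P M \<alpha> \<omega> f1 f2 = lie_deriv P Y1 f2) \<and>
         lie_bracket_on (noether_currents P M \<alpha> \<omega>) (current_bracket P M \<alpha> \<omega>)"
proof -
  have P: "smooth_manifold P"
    using assms(1) by (simp add: fiber_bundle_def)
  note facts = P assms(3)
  let ?C = "noether_currents P M \<alpha> \<omega>" and ?br = "current_bracket P M \<alpha> \<omega>"
  have zero: "0 \<in> ?C"
    unfolding noether_currents_def using noether_zero[OF facts] by blast
  have skew: "?br f g = - ?br g f" if "f \<in> ?C" "g \<in> ?C" for f g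
    using current_bracket_skew[OF facts that] .
  have add_left: "?br (f + g) h = ?br f h + ?br g h" if "f \<in> ?C" "g \<in> ?C" "h \<in> ?C" for f g h
    unfolding skew[OF noether_currents_add[OF facts that(1,2)] that(3)]
      skew[OF that(1,3)] skew[OF that(2,3)] current_bracket_add_right[OF facts that] by simp
  have scale_left: "?br (scale_form c f) g = scale_form c (?br f g)" if "f \<in> ?C" "g \<in> ?C" for c f g
    unfolding skew[OF noether_currents_scale[OF facts that(1)] that(2)] skew[OF that]
      current_bracket_scale_right[OF facts that(2,1)]
    by (simp add: scale_form_def fun_eq_iff)
  have self: "?br f f = 0" if "f \<in> ?C" for f
  proof (intro ext)
    fix Xs x
    have "?br f f Xs x = - ?br f f Xs x"
      using fun_cong[OF fun_cong[OF skew[OF that that]], of Xs x] by simp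
    then show "?br f f Xs x = 0 Xs x" by simp
  qed
  have "lie_bracket_on ?C ?br"
    unfolding lie_bracket_on_def
    by (intro conjI ballI allI zero noether_currents_add[OF facts] noether_currents_scale[OF facts]
        noether_currents_bracket[OF facts] add_left current_bracket_add_right[OF facts] scale_left
        current_bracket_scale_right[OF facts] self current_bracket_jacobi[OF facts])
  then show ?thesis
    using current_bracket_eq[OF facts] by blast
qed

end
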